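(* Let $W$ be a nonconfocal linear family of bisectors. Then there exists an $\mathbb R$-linear embedding $f:W\hookrightarrow V$, unique up to $\mathbb C^*$-proportionality, such that $h(fh)=0$ for all $h\in W$. Let $U:=\mathbb C\,fW$ be the $\mathbb C$-span of $fW$. If $U=V$, then $\dim_{\mathbb R}W=3$ and $fW\subset V$ is a totally real subspace. Otherwise, $\dim_{\mathbb C}U=2$ and the bisectors of the family share the common slice $\mathbb P_{\mathbb C}U$, i.e., $$W\subset W_U:=\big\{h\in\mathrm{Lin}_{\mathbb C}(V,V)\ \big|\ \operatorname{tr}h=0,\ h^*=h,\ hU\subset U^\perp\big\}.$$
   Context: $V$ is a 3-dimensional $\mathbb C$-linear space with a hermitian form $\langle-,-\rangle$ (linear in the first argument) of signature $++-$. $\mathbb B=\{p\in\mathbb P_{\mathbb C}V\mid\langle p,p\rangle<0\}$. $\mathrm{Lin}_{\mathbb C}(V,V)$ is the space of $\mathbb C$-linear maps $V\to V$; $h^*$ is the adjoint of $h$ with respect to $\langle-,-\rangle$. A bisector is $B_h:=\{p\in\mathbb P_{\mathbb C}V\mid\langle hp,p\rangle=0\}$, where $h\in\mathrm{Lin}_{\mathbb C}(V,V)$ has rank 2, $h^*=h$, $\operatorname{tr}h=0$, provided $B_h\ne\{f_h\}$, where $\{f_h\}=\mathbb P_{\mathbb C}\ker h$ is the focus of $B_h$. The slices of $B_h$ are the complex projective lines joining $f_h$ with points of $B_h\setminus\{f_h\}$ (they lie in $B_h$). A family of bisectors is an $\mathbb R$-linear subspace $W\subset\mathrm{Lin}_{\mathbb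 C}(V,V)$ such that $\operatorname{tr}h=0$ and $h^*=h$ for all $h\in W$, $W$ is the $\mathbb R$-span of $D_W:=\{h\in W\mid\det h=0\}$, and $B_W\cap\mathbb B\ne\varnothing$, where $B_W:=\{p\in\mathbb P_{\mathbb C}V\mid\langle hp,p\rangle=0\text{ for all }h\in W\}$. The family is linear if $D_W=W$; then every $0\ne h\in W$ has rank 2 and gives a bisector $B_h$ of the family. It is nonconfocal if $Wf_0\ne0$ for any $0\ne f_0\in V$. A 3-dimensional $\mathbb R$-linear subspace $T\subset V$ is totally real if $\mathbb CT=V$ and $\langle T,T\rangle\subset\mathbb R$. *)

theory Defs
  imports "HOL-Analysis.Analysis"
begin

text \<open>
  The 3-dimensional complex space \<open>V\<close> is \<^typ>\<open>complex ^ 3\<close>, carrying an arbitrary hermitian form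
  \<open>F\<close> of signature \<open>++-\<close>; complex linear maps \<open>V \<rightarrow> V\<close> are matrices \<^typ>\<open>complex ^ 3 ^ 3\<close> acting by
  \<open>*v\<close>.  Throughout, \<open>vec.span\<close>, \<open>vec.dim\<close>, \<open>vec.subspace\<close> are the notions over the complex field,
  while the unqualified \<open>span\<close>, \<open>dim\<close>, \<open>subspace\<close> are the notions over the reals.
\<close>

type_synonym V = "complex ^ 3"
type_synonym form = "V \<Rightarrow> V \<Rightarrow> complex"
type_synonym lin = "complex ^ 3 ^ 3"

definition hermitian_form :: "form \<Rightarrow> bool" where
  "hermitian_form F \<longleftrightarrow>
     (\<forall>x y z. F (x + y) z = F x z + F y z) \<and>
     (\<forall>c x y. F (c *s x) y = c * F x y) \<and>
     (\<forall>x y. F y x = cnj (F x y))"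

text \<open>The three vectors are automatically linearly independent, hence a basis of \<open>V\<close>.\<close>

definition signature_ppm :: "form \<Rightarrow> bool" where
  "signature_ppm F \<longleftrightarrow>
     (\<exists>e1 e2 e3. F e1 e1 = 1 \<and> F e2 e2 = 1 \<and> F e3 e3 = -1 \<and>
        F e1 e2 = 0 \<and> F e1 e3 = 0 \<and> F e2 e3 = 0)"

text \<open>For a form of the above signature the adjoint exists and is unique.\<close>

definition is_adjoint :: "form \<Rightarrow> lin \<Rightarrow> lin \<Rightarrow> bool" where
  "is_adjoint F h g \<longleftrightarrow> (\<forall>x y. F (h *v x) y = F x (g *v y))"

abbreviation self_adjoint :: "form \<Rightarrow> lin \<Rightarrow> bool" where
  "self_adjoint F h \<equiv> is_adjoint F h h"

definition orth :: "form \<Rightarrow> V set \<Rightarrow> V set" where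
  "orth F U = {v. \<forall>u\<in>U. F v u = 0}"

text \<open>
  Points of a projective space are the complex lines through the origin, so \<open>proj U\<close> is the
  projectivization of a complex subspace \<open>U\<close>, and \<open>proj UNIV\<close> is the projective plane of \<open>V\<close>.
\<close>

definition proj :: "V set \<Rightarrow> V set set" where
  "proj U = {p. vec.subspace p \<and> vec.dim p = 1 \<and> p \<subseteq> U}"

text \<open>\<open>F v v\<close> is real for a hermitian form.\<close>

definition neg_ball :: "form \<Rightarrow> V set set" where
  "neg_ball F = {p \<in> proj UNIV. \<forall>v\<in>p. v \<noteq> 0 \<longrightarrow> Re (F v v) < 0}"

definition bis :: "form \<Rightarrow> lin \<Rightarrow> V set set" where
  "bis F h = {p \<in> proj UNIV. \<forall>v\<in>p. F (h *v v) v = 0}"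

text \<open>The focus is a point of the projective plane when \<open>h\<close> has rank 2.\<close>

definition focus :: "lin \<Rightarrow> V set" where
  "focus h = {v. h *v v = 0}"

definition is_bisector :: "form \<Rightarrow> lin \<Rightarrow> bool" where
  "is_bisector F h \<longleftrightarrow>
     rank h = 2 \<and> self_adjoint F h \<and> trace h = 0 \<and> bis F h \<noteq> {focus h}"

definition is_slice :: "form \<Rightarrow> lin \<Rightarrow> V set set \<Rightarrow> bool" where
  "is_slice F h S \<longleftrightarrow>
     is_bisector F h \<and> (\<exists>p \<in> bis F h - {focus h}. S = proj (vec.span (focus h \<union> p)))"

definition singular_part :: "lin set \<Rightarrow> lin set" where
  "singular_part W = {h \<in> W. det h = 0}"

definition base_locus :: "form \<Rightarrow> lin set \<Rightarrow> V set set" where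
  "base_locus F W = {p \<in> proj UNIV. \<forall>h\<in>W. \<forall>v\<in>p. F (h *v v) v = 0}"

definition bisector_family :: "form \<Rightarrow> lin set \<Rightarrow> bool" where
  "bisector_family F W \<longleftrightarrow>
     subspace W \<and>
     (\<forall>h\<in>W. trace h = 0 \<and> self_adjoint F h) \<and>
     span (singular_part W) = W \<and>
     base_locus F W \<inter> neg_ball F \<noteq> {}"

definition linear_family :: "form \<Rightarrow> lin set \<Rightarrow> bool" where
  "linear_family F W \<longleftrightarrow> bisector_family F W \<and> singular_part W = W"

definition nonconfocal :: "lin set \<Rightarrow> bool" where
  "nonconfocal W \<longleftrightarrow> (\<forall>v. v \<noteq> 0 \<longrightarrow> (\<exists>h\<in>W. h *v v \<noteq> 0))"

definition totally_real :: "form \<Rightarrow> V set \<Rightarrow> bool" where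
  "totally_real F T \<longleftrightarrow>
     subspace T \<and> dim T = 3 \<and> vec.span T = UNIV \<and> (\<forall>x\<in>T. \<forall>y\<in>T. F x y \<in> \<real>)"

text \<open>Only the values of \<open>f\<close> on \<open>W\<close> matter.\<close>

definition real_embedding_on :: "lin set \<Rightarrow> (lin \<Rightarrow> V) \<Rightarrow> bool" where
  "real_embedding_on W f \<longleftrightarrow>
     (\<forall>h\<in>W. \<forall>k\<in>W. f (h + k) = f h + f k) \<and>
     (\<forall>r. \<forall>h\<in>W. f (r *\<^sub>R h) = r *\<^sub>R f h) \<and>
     inj_on f W"

definition focal_embedding :: "lin set \<Rightarrow> (lin \<Rightarrow> V) \<Rightarrow> bool" where
  "focal_embedding W f \<longleftrightarrow> real_embedding_on W f \<and> (\<forall>h\<in>W. h *v f h = 0)"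

definition slice_family :: "form \<Rightarrow> V set \<Rightarrow> lin set" where
  "slice_family F U =
     {h. trace h = 0 \<and> self_adjoint F h \<and> (\<lambda>v. h *v v) ` U \<subseteq> orth F U}"

end

theory Submission imports Defs
begin

text \<open>
  In an orthonormal basis containing a negative vector \<open>p\<close> of the base locus, \<open>p\<close> becomes an isotropic
  vector of every form \<open>F (h *v x) x\<close>. The kernel of a singular \<open>h\<close> can then be written down explicitly
  and, since all members of \<open>W\<close> are singular, suitably scaled it depends linearly on \<open>h\<close>; this is
  the embedding \<open>f\<close>, unique because each nonzero \<open>h\<close> has a one-dimensional kernel.
  Polarizing \<open>h (f h) = 0\<close> shows that \<open>F (h (f k)) (f l)\<close> is an alternating and purely imaginary trilinear
  form on \<open>W\<close>. If \<open>f ` W\<close> spans a plane \<open>U\<close>, the form vanishes, that is, every \<open>h\<close> maps \<open>U\<close> into its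
  orthogonal complement. If \<open>f ` W\<close> spans the whole space, then \<open>h\<close> is determined by three real
  numbers, and the images \<open>h\<^sub>i (f h\<^sub>j)\<close> of a basis give the dual basis of the \<open>f h\<^sub>i\<close>, up to a common
  factor; the trace condition makes the Gram matrix of the dual basis real, hence that of the \<open>f h\<^sub>i\<close>.
\<close>

subsection \<open>Matrices and dimensions\<close>

lemma scaleR_eq_smult: "r *\<^sub>R (x::V) = complex_of_real r *s x"
  by (simp add: vec_eq_iff) (simp add: scaleR_conv_of_real)

lemma scaleR_matrix_vector: "(r *\<^sub>R (h::lin)) *v x = complex_of_real r *s (h *v x)"
  by (simp add: vec_eq_iff matrix_vector_mult_def sum_3 algebra_simps)
    (simp add: scaleR_conv_of_real algebra_simps)

lemma common_kernel_two_functionals: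
  fixes a b :: V
  obtains x :: V where "x \<noteq> 0" "(\<Sum>j\<in>UNIV. a $ j * x $ j) = 0" "(\<Sum>j\<in>UNIV. b $ j * x $ j) = 0"
proof -
  define M :: lin where "M = vector [a, b, 0]"
  have "(M ** B) $ 3 $ 3 = 0" for B :: lin
    by (simp add: M_def matrix_matrix_mult_def)
  moreover have "(mat 1 :: lin) $ 3 $ 3 = 1"
    by (simp add: mat_def)
  ultimately have "\<nexists>B. B ** M = mat 1"
    by (metis matrix_left_right_inverse zero_neq_one)
  then obtain x where x: "x \<noteq> 0" "M *v x = 0"
    using matrix_left_invertible_ker by blast
  have "(M *v x) $ 1 = 0" "(M *v x) $ 2 = 0"
    using x by simp_all
  then show ?thesis
    using that[of x] x(1) by (simp add: M_def matrix_vector_mult_def)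
qed

lemma vec_independent_pair:
  fixes x y :: V
  assumes "x \<noteq> 0" "\<And>c. y \<noteq> c *s x"
  shows "vec.independent {x, y}" "card {x, y} = 2"
proof -
  have "y \<notin> vec.span {x}"
    using assms(2) by (auto simp: vec.span_singleton)
  then have "vec.independent {y, x}"
    using assms(1) by (intro vec.independent_insertI) (simp_all add: vec.independent_empty)
  then show "vec.independent {x, y}"
    by (simp add: insert_commute)
  show "card {x, y} = 2"
    using assms(2)[of 1] by auto
qed

lemma vec_dim_le_3: "vec.dim (S :: V set) \<le> 3"
  using vec.dim_subset_UNIV[of S] by (simp add: vec.dimension_def card_cart_basis)

lemma vec_dim_eq_3_iff: "vec.dim (S :: V set) = 3 \<longleftrightarrow> vec.span S = UNIV"
  using vec.dim_eq_full[of S] by (simp add: vec.dimension_def card_cart_basis)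

text \<open>With rank at most one, all rows would be multiples of a single \<open>r\<close>, and the
  kernel would contain a plane instead of lying in the line of \<open>v\<close>.\<close>

lemma rank_eq_2I:
  fixes h :: lin
  assumes det: "det h = 0" and nz: "h \<noteq> 0" and v: "\<And>w. h *v w = 0 \<Longrightarrow> \<exists>c. w = c *s v"
  shows "rank h = 2"
proof -
  have "vec.span (rows h) \<noteq> UNIV"
    using det matrix_left_invertible_span_rows_gen[of h] invertible_left_inverse[of h] invertible_det_nz[of h]
    by blast
  then have "vec.dim (rows h) \<noteq> 3"
    by (simp add: vec_dim_eq_3_iff)
  moreover have "vec.dim (rows h) \<le> 3"
    by (rule vec_dim_le_3)
  moreover have False if "vec.dim (rows h) \<le> 1"
  proof -
    obtain B where B: "B \<subseteq> rows h" "vec.independent B" "rows h \<subseteq> vec.span B" "card B = vec.dim (rows h)"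
      using vec.basis_exists by blast
    have "finite B"
      using B(2) vec.finiteI_independent by blast
    moreover have "card B = 0 \<or> card B = 1"
      using that B(4) by linarith
    ultimately have "B = {} \<or> (\<exists>r. B = {r})"
      by (auto simp: card_1_singleton_iff)
    then obtain r where "B \<subseteq> {r}"
      by blast
    then have "rows h \<subseteq> vec.span {r}"
      using B(3) vec.span_mono by blast
    then have "\<exists>c. row i h = c *s r" for i
      by (force simp: rows_def vec.span_singleton)
    then obtain c where "\<And>i. row i h = c i *s r"
      by metis
    then have "row i h $ j = c i * r $ j" for i j
      by simp
    then have c: "h $ i $ j = c i * r $ j" for i j
      by (simp add: row_def)
    have in_kernel: "h *v x = 0" if "r $ 1 * x $ 1 + r $ 2 * x $ 2 + r $ 3 * x $ 3 = 0" for x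
    proof -
      have "(h *v x) $ i = c i * (r $ 1 * x $ 1 + r $ 2 * x $ 2 + r $ 3 * x $ 3)" for i
        by (simp add: matrix_vector_mult_def sum_3 c algebra_simps)
      then show ?thesis
        using that by (simp add: vec_eq_iff)
    qed
    \<comment> \<open>The three test vectors are the cross products of the standard basis vectors
      with \<open>r\<close>. Being multiples of one \<open>v\<close>, they force
      \<open>r = 0\<close>.\<close>
    obtain a1 where a1: "vector [0, - r $ 3, r $ 2] = a1 *s v"
      using v[OF in_kernel[of "vector [0, - r $ 3, r $ 2]"]] by (auto simp: algebra_simps)
    obtain a2 where a2: "vector [r $ 3, 0, - r $ 1] = a2 *s v"
      using v[OF in_kernel[of "vector [r $ 3, 0, - r $ 1]"]] by (auto simp: algebra_simps)
    obtain a3 where a3: "vector [- r $ 2, r $ 1, 0] = a3 *s v"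
      using v[OF in_kernel[of "vector [- r $ 2, r $ 1, 0]"]] by (auto simp: algebra_simps)
    have eqs: "a1 * v $ 1 = 0" "a1 * v $ 2 = - r $ 3" "a1 * v $ 3 = r $ 2"
      "a2 * v $ 1 = r $ 3" "a2 * v $ 2 = 0" "a2 * v $ 3 = - r $ 1"
      "a3 * v $ 1 = - r $ 2" "a3 * v $ 2 = r $ 1" "a3 * v $ 3 = 0"
      using a1 a2 a3 by (auto simp: vec_eq_iff forall_3)
    have "r $ 1 * r $ 1 = 0" "r $ 2 * r $ 2 = 0" "r $ 3 * r $ 3 = 0"
      using eqs by algebra+
    then have "r = 0"
      by (simp add: vec_eq_iff forall_3)
    then show False
      using nz c by (simp add: vec_eq_iff)
  qed
  ultimately have "vec.dim (rows h) \<noteq> 3" "vec.dim (rows h) \<le> 3" "\<not> vec.dim (rows h) \<le> 1"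
    by blast+
  then show ?thesis
    unfolding row_rank_def_gen by linarith
qed

lemma span_3:
  fixes x y z :: "'a :: real_vector"
  shows "span {x, y, z} = {a *\<^sub>R x + b *\<^sub>R y + c *\<^sub>R z | a b c. True}"
  by (auto simp: span_insert span_singleton algebra_simps)

lemma dim_span_3:
  fixes x y z :: "'a :: real_vector"
  assumes "\<And>a b c. a *\<^sub>R x + b *\<^sub>R y + c *\<^sub>R z = 0 \<Longrightarrow> a = 0 \<and> b = 0 \<and> c = 0"
  shows "dim (span {x, y, z}) = 3"
proof -
  have z: "z \<noteq> 0"
    using assms[of 0 0 1] by auto
  have y: "y \<notin> span {z}"
    using assms[of 0 1 "- c" for c] by (auto simp: span_singleton)
  have x: "x \<notin> span {y, z}"
  proof
    assume "x \<in> span {y, z}"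
    then obtain b c where "x - b *\<^sub>R y = c *\<^sub>R z"
      by (auto simp: span_insert span_singleton)
    then have "1 *\<^sub>R x + (- b) *\<^sub>R y + (- c) *\<^sub>R z = 0"
      by simp
    then show False
      using assms by fastforce
  qed
  have "independent {x, y, z}"
    using x y z by (intro independent_insertI) (auto simp: independent_empty)
  moreover have "card {x, y, z} = 3"
    using x y span_base[of x] span_base[of y] by (auto simp: card_insert_if)
  ultimately show ?thesis
    by (simp add: dim_eq_card_independent)
qed

subsection \<open>Hermitian forms\<close>

locale hermitian =
  fixes F :: form
  assumes hermitian: "hermitian_form F"
begin

lemma add_left: "F (x + y) z = F x z + F y z"
  and smult_left: "F (c *s x) y = c * F x y"
  and cnj_swap: "F y x = cnj (F x y)"
  using hermitian unfolding hermitian_form_def by blast+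

lemma add_right: "F z (x + y) = F z x + F z y"
  by (metis add_left cnj_swap complex_cnj_add)

lemma smult_right: "F x (c *s y) = cnj c * F x y"
  by (metis smult_left cnj_swap complex_cnj_mult)

lemma zero_left [simp]: "F 0 y = 0" and zero_right [simp]: "F x 0 = 0"
  using smult_left[of 0 0] smult_right[of _ 0 0] by simp_all

lemma minus_left: "F (- x) y = - F x y" and minus_right: "F x (- y) = - F x y"
  using smult_left[of "-1"] smult_right[of _ "-1"] by simp_all

lemma diff_left: "F (x - y) z = F x z - F y z" and diff_right: "F z (x - y) = F z x - F z y"
  using add_left[of x "- y"] add_right[of z x "- y"] by (simp_all add: minus_left minus_right)

lemmas form_simps = add_left add_right smult_left smult_right minus_left minus_right diff_left diff_right

lemma sum_left: "finite A \<Longrightarrow> F (\<Sum>a\<in>A. f a) y = (\<Sum>a\<in>A. F (f a) y)"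
  by (induction A rule: finite_induct) (auto simp: add_left)

lemma left_components: "F x y = (\<Sum>j\<in>UNIV. F (axis j 1) y * x $ j)"
proof -
  have "F x y = F (\<Sum>j\<in>UNIV. x $ j *s axis j 1) y"
    by (simp add: basis_expansion)
  then show ?thesis
    by (simp add: sum_left smult_left mult.commute)
qed

lemma form_self_real: "F x x = complex_of_real (Re (F x x))"
  by (metis cnj_swap Reals_cnj_iff complex_is_Real_iff of_real_Re)

text \<open>\<open>M\<close> reads coordinates against the \<open>g i\<close> and \<open>Q\<close>
  recombines the \<open>f i\<close>. The pairing gives \<open>M ** Q = mat 1\<close>, and a
  one-sided inverse of a square matrix is two-sided.\<close>

lemma dual_expansion:
  assumes "\<And>i j. F (f i) (g j) = (if i = j then 1 else 0)"
  shows "x = (\<Sum>i\<in>UNIV. F x (g i) *s f (i::3))"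
proof -
  define M :: lin where "M = (\<chi> i j. F (axis j 1) (g i))"
  define Q :: lin where "Q = (\<chi> i j. f j $ i)"
  have M: "(M *v y) $ i = F y (g i)" for y i
    by (simp add: M_def matrix_vector_mult_def left_components[of y])
  have Q: "Q *v c = (\<Sum>i\<in>UNIV. c $ i *s f i)" for c
    by (simp add: Q_def matrix_vector_mult_def vec_eq_iff mult.commute)
  have "(M *v (Q *v c)) = c" for c
    unfolding Q vec_eq_iff M by (simp add: sum_left smult_left assms if_distrib cong: if_cong)
  then have "M ** Q = mat 1"
    by (simp add: matrix_eq matrix_vector_mul_assoc)
  then have "Q *v (M *v x) = x"
    by (metis matrix_left_right_inverse matrix_vector_mul_assoc matrix_vector_mul_lid)
  then show ?thesis
    by (simp add: Q M)
qed

lemma dual_expansion_3: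
  assumes "F f1 g1 = 1" "F f2 g1 = 0" "F f3 g1 = 0"
    and "F f1 g2 = 0" "F f2 g2 = 1" "F f3 g2 = 0"
    and "F f1 g3 = 0" "F f2 g3 = 0" "F f3 g3 = 1"
  shows "x = F x g1 *s f1 + F x g2 *s f2 + F x g3 *s f3"
proof -
  define f :: "3 \<Rightarrow> V" where "f i = vector [f1, f2, f3] $ i" for i
  define g :: "3 \<Rightarrow> V" where "g i = vector [g1, g2, g3] $ i" for i
  have "\<forall>i j. F (f i) (g j) = (if i = j then 1 else 0)"
    by (simp add: forall_3 f_def g_def assms)
  from dual_expansion[of f g x] this show ?thesis
    by (simp add: sum_3 f_def g_def)
qed

text \<open>Expanding each axis vector and resumming the components lets the trace be taken in any
  basis with a known dual basis.\<close>

lemma trace_dual: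
  assumes "\<And>x. x = F x g1 *s f1 + F x g2 *s f2 + F x g3 *s f3"
  shows "trace h = F (h *v f1) g1 + F (h *v f2) g2 + F (h *v f3) g3"
proof -
  have "h $ i $ i = F (axis i 1) g1 * (h *v f1) $ i + F (axis i 1) g2 * (h *v f2) $ i
      + F (axis i 1) g3 * (h *v f3) $ i" for i
  proof -
    have "h $ i $ i = (h *v axis i 1) $ i"
      by (simp add: matrix_vector_mult_def axis_def if_distrib cong: if_cong)
    also have "h *v axis i 1 = h *v (F (axis i 1) g1 *s f1 + F (axis i 1) g2 *s f2 + F (axis i 1) g3 *s f3)"
      using assms by metis
    finally show ?thesis
      by (simp add: matrix_vector_right_distrib vector_scalar_commute)
  qed
  then show ?thesis
    by (simp add: trace_def left_components[of "_ *v _"] sum.distrib)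
qed

end

section \<open>Signature ++-: orthonormal bases through a negative vector\<close>

locale hermitian_ppm = hermitian +
  assumes signature: "signature_ppm F"
begin

lemma nondegenerate: "x = 0" if "\<And>y. F x y = 0"
proof -
  obtain e1 e2 e3 where e: "F e1 e1 = 1" "F e2 e2 = 1" "F e3 e3 = -1"
    "F e1 e2 = 0" "F e1 e3 = 0" "F e2 e3 = 0"
    using signature unfolding signature_ppm_def by blast
  then have e': "F e2 e1 = 0" "F e3 e1 = 0" "F e3 e2 = 0"
    by (metis cnj_swap complex_cnj_zero)+
  \<comment> \<open>The dual of \<open>e3\<close> is \<open>- e3\<close>, because
    \<open>F e3 e3 = -1\<close>.\<close>
  have "x = F x e1 *s e1 + F x e2 *s e2 + F x (- e3) *s e3"
    by (rule dual_expansion_3) (simp_all add: form_simps e e')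
  then show ?thesis
    using that by simp
qed

text \<open>A reversed Cauchy-Schwarz argument: orthogonality bounds the product of the third
  coordinates by the positive parts, while negativity makes the third coordinate of \<open>p\<close>
  dominate.\<close>

lemma orthogonal_negative_positive:
  assumes "Re (F p p) < 0" "F x p = 0" "x \<noteq> 0"
  shows "Re (F x x) > 0"
proof -
  obtain e1 e2 e3 where e: "F e1 e1 = 1" "F e2 e2 = 1" "F e3 e3 = -1"
    "F e1 e2 = 0" "F e1 e3 = 0" "F e2 e3 = 0"
    using signature unfolding signature_ppm_def by blast
  then have e': "F e2 e1 = 0" "F e3 e1 = 0" "F e3 e2 = 0"
    by (metis cnj_swap complex_cnj_zero)+
  have expand: "y = F y e1 *s e1 + F y e2 *s e2 + F y (- e3) *s e3" for y
    by (rule dual_expansion_3) (simp_all add: form_simps e e')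
  obtain p1 p2 p3 where p: "p = p1 *s e1 + p2 *s e2 + p3 *s e3"
    using expand by blast
  obtain x1 x2 x3 where x: "x = x1 *s e1 + x2 *s e2 + x3 *s e3"
    using expand by blast
  have Fpp: "Re (F p p) = (cmod p1)\<^sup>2 + (cmod p2)\<^sup>2 - (cmod p3)\<^sup>2"
    by (simp add: p form_simps e e' cmod_power2) (simp add: power2_eq_square)
  have Fxx: "Re (F x x) = (cmod x1)\<^sup>2 + (cmod x2)\<^sup>2 - (cmod x3)\<^sup>2"
    by (simp add: x form_simps e e' cmod_power2) (simp add: power2_eq_square)
  have "x1 * cnj p1 + x2 * cnj p2 = x3 * cnj p3"
    using assms(2) by (simp add: p x form_simps e e' algebra_simps)
  then have "cmod x3 * cmod p3 \<le> cmod x1 * cmod p1 + cmod x2 * cmod p2"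
    by (metis complex_mod_cnj norm_mult norm_triangle_ineq)
  then have "(cmod x3 * cmod p3)\<^sup>2 \<le> (cmod x1 * cmod p1 + cmod x2 * cmod p2)\<^sup>2"
    by (simp add: power_mono)
  also have "\<dots> \<le> ((cmod x1)\<^sup>2 + (cmod x2)\<^sup>2) * ((cmod p1)\<^sup>2 + (cmod p2)\<^sup>2)"
    using zero_le_power2[of "cmod x1 * cmod p2 - cmod x2 * cmod p1"]
    by (simp add: power2_eq_square algebra_simps)
  finally have ineq: "(cmod x3)\<^sup>2 * (cmod p3)\<^sup>2 \<le> ((cmod x1)\<^sup>2 + (cmod x2)\<^sup>2) * ((cmod p1)\<^sup>2 + (cmod p2)\<^sup>2)"
    by (simp add: power_mult_distrib)
  have p3: "(cmod p1)\<^sup>2 + (cmod p2)\<^sup>2 < (cmod p3)\<^sup>2"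
    using assms(1) Fpp by simp
  have pos: "(cmod x1)\<^sup>2 + (cmod x2)\<^sup>2 > 0"
  proof (rule ccontr)
    assume "\<not> ?thesis"
    then have "x1 = 0" "x2 = 0"
      by (simp_all add: not_less sum_power2_le_zero_iff)
    moreover have "cmod p3 \<noteq> 0"
      using p3 by (smt (verit) zero_le_power2 power_zero_numeral)
    ultimately have "x = 0"
      using ineq by (simp add: x mult_le_0_iff)
    then show False
      using assms(3) by simp
  qed
  have "(cmod x3)\<^sup>2 * (cmod p3)\<^sup>2 < ((cmod x1)\<^sup>2 + (cmod x2)\<^sup>2) * (cmod p3)\<^sup>2"
    using ineq p3 pos by (meson le_less_trans mult_strict_left_mono)
  then show ?thesis
    unfolding Fxx by (simp add: mult_less_cancel_right)
qed

lemma normalize: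
  assumes "Re (F x x) \<noteq> 0"
  obtains c where "c \<noteq> 0" "F (c *s x) (c *s x) = sgn (Re (F x x))"
proof
  define r where "r = Re (F x x)"
  let ?c = "complex_of_real (1 / sqrt \<bar>r\<bar>)"
  have "r \<noteq> 0"
    using assms r_def by simp
  then show "?c \<noteq> 0"
    by simp
  have "F (?c *s x) (?c *s x) = complex_of_real ((1 / sqrt \<bar>r\<bar>)\<^sup>2 * r)"
    using form_self_real[of x] unfolding r_def[symmetric]
    by (simp add: form_simps power2_eq_square) (simp flip: of_real_mult)
  also have "(1 / sqrt \<bar>r\<bar>)\<^sup>2 * r = sgn r"
    using \<open>r \<noteq> 0\<close> by (simp add: power_divide sgn_if)
  finally show "F (?c *s x) (?c *s x) = sgn (Re (F x x))"
    by (simp add: r_def)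
qed

lemma orthonormal_basis_at_negative:
  assumes "Re (F p p) < 0"
  obtains u1 u2 c where "c \<noteq> 0" "F u1 u1 = 1" "F u2 u2 = 1" "F (c *s p) (c *s p) = -1"
    "F u1 u2 = 0" "F u1 (c *s p) = 0" "F u2 (c *s p) = 0"
proof -
  \<comment> \<open>Applied with \<open>q = u1\<close>, the same claim also produces the second
    basis vector.\<close>
  have ex: "\<exists>u. F u u = 1 \<and> F u p = 0 \<and> F u q = 0" for q
  proof -
    obtain x where x: "x \<noteq> 0" "F x p = 0" "F x q = 0"
      using common_kernel_two_functionals[of "\<chi> j. F (axis j 1) p" "\<chi> j. F (axis j 1) q"]
      by (metis (no_types, lifting) left_components sum.cong vec_lambda_beta)
    then have pos: "Re (F x x) > 0"
      using orthogonal_negative_positive[OF assms] by simp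
    then obtain c where "F (c *s x) (c *s x) = sgn (Re (F x x))"
      using normalize by (metis less_irrefl)
    with pos x show ?thesis
      by (intro exI[of _ "c *s x"]) (simp add: smult_left)
  qed
  obtain u1 where u1: "F u1 u1 = 1" "F u1 p = 0"
    using ex by blast
  obtain u2 where u2: "F u2 u2 = 1" "F u2 p = 0" "F u2 u1 = 0"
    using ex by blast
  obtain c where c: "c \<noteq> 0" "F (c *s p) (c *s p) = sgn (Re (F p p))"
    using normalize assms by (metis less_irrefl)
  show ?thesis
    using that[OF c(1) u1(1) u2(1)] c u1 u2 assms cnj_swap[of u1 u2] by (simp add: smult_right)
qed

end

subsection \<open>Kernels of the members of the family\<close>

text \<open>The hypotheses of the theorem seen from a point of the base locus inside the ball:
  \<open>p\<close> is a representative scaled to \<open>F p p = -1\<close> and completed to an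
  orthonormal basis, so that members of \<open>W\<close> become explicit matrices.\<close>

locale adapted_family = hermitian_ppm +
  fixes W :: "lin set" and u1 u2 p :: V
  assumes basis: "F u1 u1 = 1" "F u2 u2 = 1" "F p p = -1" "F u1 u2 = 0" "F u1 p = 0" "F u2 p = 0"
    and subspace_W: "subspace W"
    and trace_W: "h \<in> W \<Longrightarrow> trace h = 0"
    and selfadj: "h \<in> W \<Longrightarrow> F (h *v x) y = F x (h *v y)"
    and det_W: "h \<in> W \<Longrightarrow> det h = 0"
    and base_W: "h \<in> W \<Longrightarrow> F (h *v p) p = 0"
    and nonconf: "v \<noteq> 0 \<Longrightarrow> \<exists>h\<in>W. h *v v \<noteq> 0"
begin

lemma basis': "F u2 u1 = 0" "F p u1 = 0" "F p u2 = 0"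
  using basis by (metis cnj_swap complex_cnj_zero)+

lemma expand: "x = F x u1 *s u1 + F x u2 *s u2 + F x (- p) *s p"
  by (rule dual_expansion_3) (simp_all add: form_simps basis basis')

lemma eq_zero_iff: "x = 0 \<longleftrightarrow> F x u1 = 0 \<and> F x u2 = 0 \<and> F x p = 0"
  using expand[of x] by (auto simp: minus_right)

lemma W_closed: "h \<in> W \<Longrightarrow> k \<in> W \<Longrightarrow> h + k \<in> W" "h \<in> W \<Longrightarrow> k \<in> W \<Longrightarrow> h - k \<in> W"
  "h \<in> W \<Longrightarrow> r *\<^sub>R h \<in> W" "0 \<in> W"
  using subspace_W by (auto simp: subspace_def subspace_diff)

text \<open>
  In the basis \<open>u1, u2, p\<close> the hermitian form \<open>F (h *v x) x\<close> of a member of \<open>W\<close> has the matrix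
  with rows (for \<open>diag\<close>, \<open>offdiag\<close>, \<open>col1\<close>, \<open>col2\<close> of \<open>h\<close>) \<open>(d, o, c1)\<close>, \<open>(cnj o, - d, c2)\<close>, \<open>(cnj c1, cnj c2, 0)\<close>: the last entry vanishes because
  \<open>p\<close> lies in the base locus, and then the trace condition makes the upper left block traceless.
\<close>

definition diag :: "lin \<Rightarrow> complex" where "diag h = F (h *v u1) u1"
definition offdiag :: "lin \<Rightarrow> complex" where "offdiag h = F (h *v u2) u1"
definition col1 :: "lin \<Rightarrow> complex" where "col1 h = F (h *v p) u1"
definition col2 :: "lin \<Rightarrow> complex" where "col2 h = F (h *v p) u2"

lemma entry_add:
  "diag (h + k) = diag h + diag k" "offdiag (h + k) = offdiag h + offdiag k"
  "col1 (h + k) = col1 h + col1 k" "col2 (h + k) = col2 h + col2 k"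
  by (simp_all add: diag_def offdiag_def col1_def col2_def matrix_vector_mult_add_rdistrib add_left)

lemma entry_diff:
  "diag (h - k) = diag h - diag k" "offdiag (h - k) = offdiag h - offdiag k"
  "col1 (h - k) = col1 h - col1 k" "col2 (h - k) = col2 h - col2 k"
  by (simp_all add: diag_def offdiag_def col1_def col2_def matrix_vector_mult_diff_rdistrib diff_left)

lemma entry_scaleR:
  "diag (r *\<^sub>R h) = r * diag h" "offdiag (r *\<^sub>R h) = r * offdiag h"
  "col1 (r *\<^sub>R h) = r * col1 h" "col2 (r *\<^sub>R h) = r * col2 h"
  by (simp_all add: diag_def offdiag_def col1_def col2_def scaleR_matrix_vector smult_left)

context
  fixes h assumes h: "h \<in> W"
begin

lemma cnj_diag: "cnj (diag h) = diag h"
  unfolding diag_def using cnj_swap selfadj[OF h] by metis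

lemma entries:
  "F (h *v u1) u1 = diag h" "F (h *v u2) u1 = offdiag h" "F (h *v p) u1 = col1 h"
  "F (h *v u1) u2 = cnj (offdiag h)" "F (h *v u2) u2 = - diag h" "F (h *v p) u2 = col2 h"
  "F (h *v u1) p = cnj (col1 h)" "F (h *v u2) p = cnj (col2 h)" "F (h *v p) p = 0"
proof -
  have "trace h = F (h *v u1) u1 + F (h *v u2) u2 + F (h *v p) (- p)"
    by (rule trace_dual) (rule expand)
  then show "F (h *v u2) u2 = - diag h"
    using trace_W[OF h] base_W[OF h] by (simp add: minus_right diag_def eq_neg_iff_add_eq_0 add.commute)
qed (use base_W[OF h] in \<open>simp_all add: diag_def offdiag_def col1_def col2_def\<close>,
    (metis cnj_swap selfadj[OF h])+)

lemma image_entries: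
  "F (h *v (a *s u1 + b *s u2 + c *s p)) u1 = a * diag h + b * offdiag h + c * col1 h"
  "F (h *v (a *s u1 + b *s u2 + c *s p)) u2 = a * cnj (offdiag h) - b * diag h + c * col2 h"
  "F (h *v (a *s u1 + b *s u2 + c *s p)) p = a * cnj (col1 h) + b * cnj (col2 h)"
  by (simp_all add: matrix_vector_right_distrib vector_scalar_commute add_left smult_left entries)

lemma image_eq_0_iff:
  "h *v (a *s u1 + b *s u2 + c *s p) = 0 \<longleftrightarrow>
    a * diag h + b * offdiag h + c * col1 h = 0 \<and>
    a * cnj (offdiag h) - b * diag h + c * col2 h = 0 \<and>
    a * cnj (col1 h) + b * cnj (col2 h) = 0"
  unfolding eq_zero_iff image_entries ..

lemma eq_0_iff: "h = 0 \<longleftrightarrow> diag h = 0 \<and> offdiag h = 0 \<and> col1 h = 0 \<and> col2 h = 0"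
proof
  assume "diag h = 0 \<and> offdiag h = 0 \<and> col1 h = 0 \<and> col2 h = 0"
  then have "h *v (a *s u1 + b *s u2 + c *s p) = 0" for a b c
    by (simp add: image_eq_0_iff)
  then have "h *v x = 0" for x
    by (metis expand)
  then show "h = 0"
    by (simp add: matrix_eq)
qed (simp add: diag_def offdiag_def col1_def col2_def)

lemma exists_kernel_vector: "\<exists>v. v \<noteq> 0 \<and> h *v v = 0"
  using det_W[OF h] matrix_left_invertible_ker[of h] invertible_det_nz[of h] invertible_left_inverse[of h]
  by blast

text \<open>The square of the traceless hermitian block is the scalar \<open>d^2 + |o|^2\<close>
  with \<open>d\<close> real. A nonzero kernel vector makes this scalar vanish, hence both
  entries.\<close>

lemma singular_entries_0:
  assumes "a * diag h + b * offdiag h = 0" "a * cnj (offdiag h) - b * diag h = 0" "a \<noteq> 0 \<or> b \<noteq> 0"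
  shows "diag h = 0" "offdiag h = 0"
proof -
  have "b * (diag h * diag h + offdiag h * cnj (offdiag h)) = 0"
    "a * (diag h * diag h + offdiag h * cnj (offdiag h)) = 0"
    using assms by algebra+
  then have "diag h * diag h + offdiag h * cnj (offdiag h) = 0"
    using assms(3) by auto
  moreover obtain r where r: "diag h = complex_of_real r"
    using cnj_diag by (metis Reals_cases Reals_cnj_iff)
  ultimately have "complex_of_real (r\<^sup>2 + (cmod (offdiag h))\<^sup>2) = 0"
    by (simp add: power2_eq_square complex_norm_square[symmetric] flip: of_real_mult of_real_add complex_norm_square)
  then have "r = 0 \<and> cmod (offdiag h) = 0"
    by (simp only: of_real_eq_0_iff sum_power2_eq_zero_iff)
  then show "diag h = 0" "offdiag h = 0"
    using r by auto
qed

text \<open>If the upper left block vanishes, the kernel is cut out by \<open>c = 0\<close> and one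
  nontrivial equation in \<open>a, b\<close>. Otherwise the block is invertible, and a kernel vector
  is determined by its \<open>p\<close> coefficient.\<close>

lemma kernel_line:
  assumes "h \<noteq> 0" "v \<noteq> 0" "h *v v = 0" "h *v w = 0"
  shows "\<exists>c. w = c *s v"
proof -
  obtain a b c where v: "v = a *s u1 + b *s u2 + c *s p"
    using expand by blast
  obtain a' b' c' where w: "w = a' *s u1 + b' *s u2 + c' *s p"
    using expand by blast
  have eqs: "a * diag h + b * offdiag h + c * col1 h = 0"
    "a * cnj (offdiag h) - b * diag h + c * col2 h = 0" "a * cnj (col1 h) + b * cnj (col2 h) = 0"
    "a' * diag h + b' * offdiag h + c' * col1 h = 0"
    "a' * cnj (offdiag h) - b' * diag h + c' * col2 h = 0" "a' * cnj (col1 h) + b' * cnj (col2 h) = 0"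
    using assms(3,4) by (simp_all add: v w image_eq_0_iff)
  show ?thesis
  proof (cases "diag h = 0 \<and> offdiag h = 0")
    case True
    then have "c = 0" "c' = 0" "col1 h \<noteq> 0 \<or> col2 h \<noteq> 0"
      using eqs assms(1) eq_0_iff by auto
    moreover have "cnj (col1 h) * (a * b' - a' * b) = 0" "cnj (col2 h) * (a * b' - a' * b) = 0"
      using eqs by algebra+
    ultimately have "a * b' = a' * b"
      by auto
    moreover have "a \<noteq> 0 \<or> b \<noteq> 0"
      using assms(2) v \<open>c = 0\<close> by auto
    ultimately obtain d where "d * a = a'" "d * b = b'"
      by (metis nonzero_eq_divide_eq mult.commute times_divide_eq_left)
    then have "w = d *s v"
      unfolding v w using \<open>c = 0\<close> \<open>c' = 0\<close> by (simp add: vector_add_ldistrib vector_smult_assoc)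
    then show ?thesis
      by blast
  next
    case False
    \<comment> \<open>\<open>c' *s v - c *s w\<close> lies in the kernel and has no \<open>p\<close>
      component, so its coefficients are killed by the invertible block.\<close>
    have "(c' * a - c * a') * diag h + (c' * b - c * b') * offdiag h = 0"
      "(c' * a - c * a') * cnj (offdiag h) - (c' * b - c * b') * diag h = 0"
      using eqs by algebra+
    then have minors: "c' * a = c * a'" "c' * b = c * b'"
      using singular_entries_0[of "c' * a - c * a'" "c' * b - c * b'"] False by auto
    have "c \<noteq> 0"
    proof
      assume "c = 0"
      then have "a \<noteq> 0 \<or> b \<noteq> 0"
        using assms(2) v by auto
      then show False
        using singular_entries_0[of a b] eqs \<open>c = 0\<close> False by auto
    qed
    then have "c' / c * a = a'" "c' / c * b = b'" "c' / c * c = c'"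
      using minors by (simp_all add: field_simps)
    then have "w = (c' / c) *s v"
      unfolding v w by (simp only: vector_add_ldistrib vector_smult_assoc)
    then show ?thesis
      by blast
  qed
qed

text \<open>
  A traceless hermitian \<open>2 \<times> 2\<close> block is zero or invertible, so if \<open>(c1, c2) \<noteq> 0\<close>, then a kernel vector
  is a nonzero multiple of \<open>(- cnj c2, cnj c1, t)\<close>; if \<open>(c1, c2) = 0\<close>, then the relation is void.
\<close>

lemma singular_relation:
  "\<exists>t. - cnj (col2 h) * diag h + cnj (col1 h) * offdiag h + t * col1 h = 0 \<and>
     - cnj (col2 h) * cnj (offdiag h) - cnj (col1 h) * diag h + t * col2 h = 0"
proof (cases "col1 h = 0 \<and> col2 h = 0")
  case False
  obtain v where "v \<noteq> 0" "h *v v = 0"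
    using exists_kernel_vector by blast
  moreover obtain a b c where v: "v = a *s u1 + b *s u2 + c *s p"
    using expand by blast
  ultimately have eqs: "a * diag h + b * offdiag h + c * col1 h = 0"
    "a * cnj (offdiag h) - b * diag h + c * col2 h = 0" "a * cnj (col1 h) + b * cnj (col2 h) = 0"
    and nz: "a \<noteq> 0 \<or> b \<noteq> 0 \<or> c \<noteq> 0"
    by (auto simp: image_eq_0_iff)
  \<comment> \<open>The third equation makes \<open>(a, b)\<close> a multiple \<open>s\<close> of
    \<open>(- cnj (col2 h), cnj (col1 h))\<close>; \<open>s\<close> is read off a nonvanishing
    entry.\<close>
  define s where "s = (if col1 h = 0 then - a / cnj (col2 h) else b / cnj (col1 h))"
  have ab: "a = - s * cnj (col2 h)" "b = s * cnj (col1 h)"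
    using False eqs(3) by (auto simp: s_def field_simps add_eq_0_iff)
  have "s \<noteq> 0"
    using nz ab eqs False by auto
  then show ?thesis
    using eqs(1,2) unfolding ab by (intro exI[of _ "c / s"]) (auto simp: field_simps)
qed auto

end

end

subsection \<open>Existence of the embedding\<close>

context adapted_family
begin

lemma adapted_coefficients:
  "F (a *s u1 + b *s u2 + c *s p) u1 = a" "F (a *s u1 + b *s u2 + c *s p) u2 = b"
  "F (a *s u1 + b *s u2 + c *s p) p = - c"
  by (simp_all add: form_simps basis basis')

text \<open>Common endgame of both existence cases, where the embedding is given by its coefficients
  in the adapted basis; linearity reduces injectivity to a trivial kernel.\<close>

lemma focal_embeddingI:
  assumes add: "\<And>h k. a (h + k) = a h + a k" "\<And>h k. b (h + k) = b h + b k" "\<And>h k. c (h + k) = c h + c k"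
    and scale: "\<And>r h. a (r *\<^sub>R h) = of_real r * a h" "\<And>r h. b (r *\<^sub>R h) = of_real r * b h"
      "\<And>r h. c (r *\<^sub>R h) = of_real r * c h"
    and ker: "\<And>h. h \<in> W \<Longrightarrow> h *v (a h *s u1 + b h *s u2 + c h *s p) = 0"
    and inj: "\<And>h. h \<in> W \<Longrightarrow> a h *s u1 + b h *s u2 + c h *s p = 0 \<Longrightarrow> h = 0"
  shows "focal_embedding W (\<lambda>h. a h *s u1 + b h *s u2 + c h *s p)" (is "focal_embedding W ?f")
proof -
  have f_add: "?f (h + k) = ?f h + ?f k" for h k
    by (simp add: add vector_sadd_rdistrib algebra_simps)
  have f_scale: "?f (r *\<^sub>R h) = r *\<^sub>R ?f h" for r h
    by (simp add: scale scaleR_eq_smult vector_add_ldistrib vector_smult_assoc)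
  have "inj_on ?f W"
  proof (rule inj_onI)
    fix h k assume hk: "h \<in> W" "k \<in> W" "?f h = ?f k"
    have "?f (h - k) = ?f h + ?f ((-1) *\<^sub>R k)"
      using f_add[of h "(-1) *\<^sub>R k"] by simp
    also have "\<dots> = 0"
      unfolding f_scale hk(3) by simp
    finally show "h = k"
      using inj[of "h - k"] hk W_closed(2) by simp
  qed
  then show ?thesis
    unfolding focal_embedding_def real_embedding_on_def using f_add f_scale ker by blast
qed

text \<open>
  Here all \<open>(c1, c2)\<close> are multiples \<open>z (\<beta>1, \<beta>2)\<close> of one vector, and the embedding is the complex linear
  expression \<open>(- cnj \<beta>2 z, cnj \<beta>1 z, \<alpha>)\<close>, unlike the one antilinear in \<open>(c1, c2)\<close> of the other case.
\<close>

lemma exists_focal_embedding_dependent: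
  assumes dep: "\<And>h k. h \<in> W \<Longrightarrow> k \<in> W \<Longrightarrow> col1 h * col2 k = col2 h * col1 k"
  shows "\<exists>f. focal_embedding W f"
proof -
  have "p \<noteq> 0"
    using basis by auto
  \<comment> \<open>Nonconfocality at \<open>p\<close> yields a member with nonzero column
    \<open>(col1, col2)\<close>, used as the reference direction.\<close>
  then obtain h0 where h0: "h0 \<in> W" "h0 *v p \<noteq> 0"
    using nonconf by blast
  define \<beta>1 where "\<beta>1 = col1 h0"
  define \<beta>2 where "\<beta>2 = col2 h0"
  have \<beta>: "\<beta>1 \<noteq> 0 \<or> \<beta>2 \<noteq> 0"
    using h0 eq_zero_iff[of "h0 *v p"] base_W by (auto simp: \<beta>1_def \<beta>2_def col1_def col2_def)
  define n where "n = \<beta>1 * cnj \<beta>1 + \<beta>2 * cnj \<beta>2"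
  have "n = complex_of_real ((cmod \<beta>1)\<^sup>2 + (cmod \<beta>2)\<^sup>2)"
    by (simp add: n_def flip: complex_norm_square)
  then have n: "n \<noteq> 0"
    using \<beta> by (simp only: of_real_eq_0_iff sum_power2_eq_zero_iff) auto
  \<comment> \<open>The coefficient of the column of \<open>h\<close> along the reference direction,
    by hermitian projection.\<close>
  define z where "z h = (cnj \<beta>1 * col1 h + cnj \<beta>2 * col2 h) / n" for h
  have col: "col1 h = z h * \<beta>1" "col2 h = z h * \<beta>2" if "h \<in> W" for h
  proof -
    have "col1 h * n = (cnj \<beta>1 * col1 h + cnj \<beta>2 * col2 h) * \<beta>1"
      "col2 h * n = (cnj \<beta>1 * col1 h + cnj \<beta>2 * col2 h) * \<beta>2"
      using dep[OF that h0(1)] unfolding \<beta>1_def[symmetric] \<beta>2_def[symmetric] n_def by algebra+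
    then show "col1 h = z h * \<beta>1" "col2 h = z h * \<beta>2"
      using n by (simp_all add: z_def field_simps)
  qed
  \<comment> \<open>\<open>(X1 h, X2 h)\<close> is the block of \<open>h\<close> applied to the
    fixed vector \<open>(- cnj \<beta>2, cnj \<beta>1)\<close>. The goal is to show that it equals
    \<open>- \<alpha> h\<close> times \<open>(\<beta>1, \<beta>2)\<close>.\<close>
  define X1 where "X1 h = - cnj \<beta>2 * diag h + cnj \<beta>1 * offdiag h" for h
  define X2 where "X2 h = - cnj \<beta>2 * cnj (offdiag h) - cnj \<beta>1 * diag h" for h
  define \<alpha> where "\<alpha> h = - (cnj \<beta>1 * X1 h + cnj \<beta>2 * X2 h) / n" for h
  have lin: "z (h + k) = z h + z k" "z (r *\<^sub>R h) = of_real r * z h"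
    "X1 (h + k) = X1 h + X1 k" "X1 (r *\<^sub>R h) = of_real r * X1 h"
    "X2 (h + k) = X2 h + X2 k" "X2 (r *\<^sub>R h) = of_real r * X2 h" for h k r
    by (simp_all add: z_def X1_def X2_def entry_add entry_scaleR field_simps add_divide_distrib)
  have lin\<alpha>: "\<alpha> (h + k) = \<alpha> h + \<alpha> k" "\<alpha> (r *\<^sub>R h) = of_real r * \<alpha> h" for h k r
    unfolding \<alpha>_def lin using n by (simp_all add: field_simps)
  have ex_nonzero: "X1 h * \<beta>2 = X2 h * \<beta>1" if hz: "h \<in> W" "z h \<noteq> 0" for h
  proof -
    obtain t where t: "- cnj (col2 h) * diag h + cnj (col1 h) * offdiag h + t * col1 h = 0"
      "- cnj (col2 h) * cnj (offdiag h) - cnj (col1 h) * diag h + t * col2 h = 0"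
      using singular_relation[OF hz(1)] by blast
    then have "cnj (z h) * X1 h + t * z h * \<beta>1 = 0" "cnj (z h) * X2 h + t * z h * \<beta>2 = 0"
      by (simp_all add: X1_def X2_def col[OF that(1)] algebra_simps)
    then have "cnj (z h) * (X1 h * \<beta>2 - X2 h * \<beta>1) = 0"
      by algebra
    then show ?thesis
      using that by simp
  qed
  have z0: "z h0 = 1"
    using n by (simp add: z_def n_def \<beta>1_def \<beta>2_def mult.commute)
  \<comment> \<open>The singular relation is informative only for \<open>z h \<noteq> 0\<close>. If
    \<open>z h = 0\<close>, pass to \<open>h + h0\<close>, whose coefficient is 1, and
    subtract.\<close>
  have prop_X: "X1 h * \<beta>2 = X2 h * \<beta>1" if "h \<in> W" for h
  proof (cases "z h = 0")
    case True
    then have "X1 (h + h0) * \<beta>2 = X2 (h + h0) * \<beta>1"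
      using ex_nonzero[of "h + h0"] W_closed that h0 by (simp add: lin z0)
    moreover have "X1 h0 * \<beta>2 = X2 h0 * \<beta>1"
      using ex_nonzero[of h0] h0 z0 by simp
    ultimately show ?thesis
      by (simp add: lin algebra_simps)
  qed (use ex_nonzero that in blast)
  have X: "X1 h = - \<alpha> h * \<beta>1" "X2 h = - \<alpha> h * \<beta>2" if "h \<in> W" for h
  proof -
    have "X1 h * n = (cnj \<beta>1 * X1 h + cnj \<beta>2 * X2 h) * \<beta>1"
      "X2 h * n = (cnj \<beta>1 * X1 h + cnj \<beta>2 * X2 h) * \<beta>2"
      using prop_X[OF that] unfolding n_def by algebra+
    then show "X1 h = - \<alpha> h * \<beta>1" "X2 h = - \<alpha> h * \<beta>2"
      using n by (simp_all add: \<alpha>_def field_simps)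
  qed
  have "focal_embedding W (\<lambda>h. (- cnj \<beta>2 * z h) *s u1 + (cnj \<beta>1 * z h) *s u2 + \<alpha> h *s p)"
  proof (rule focal_embeddingI)
    fix h assume h: "h \<in> W"
    have "- cnj \<beta>2 * z h * diag h + cnj \<beta>1 * z h * offdiag h + \<alpha> h * col1 h = z h * (X1 h + \<alpha> h * \<beta>1)"
      "- cnj \<beta>2 * z h * cnj (offdiag h) - cnj \<beta>1 * z h * diag h + \<alpha> h * col2 h = z h * (X2 h + \<alpha> h * \<beta>2)"
      by (simp_all add: col[OF h] X1_def X2_def algebra_simps)
    then show "h *v ((- cnj \<beta>2 * z h) *s u1 + (cnj \<beta>1 * z h) *s u2 + \<alpha> h *s p) = 0"
      unfolding image_eq_0_iff[OF h] X[OF h] by (simp add: col[OF h])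
  next
    fix h assume h: "h \<in> W" and "(- cnj \<beta>2 * z h) *s u1 + (cnj \<beta>1 * z h) *s u2 + \<alpha> h *s p = 0"
    then have "- cnj \<beta>2 * z h = 0" "cnj \<beta>1 * z h = 0" "\<alpha> h = 0"
      unfolding eq_zero_iff adapted_coefficients by simp_all
    then have "z h = 0" "X1 h = 0" "X2 h = 0"
      using \<beta> X[OF h] by auto
    then show "h = 0"
      using singular_entries_0[OF h, of "- cnj \<beta>2" "cnj \<beta>1"] \<beta> col[OF h] eq_0_iff[OF h]
      by (auto simp: X1_def X2_def)
  qed (simp_all add: lin lin\<alpha> algebra_simps)
  then show ?thesis
    by (rule exI[of "focal_embedding W"])
qed

text \<open>\<open>(cross1 h k, cross2 h k)\<close> is the block of \<open>h\<close> applied to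
  \<open>(- cnj (col2 k), cnj (col1 k))\<close>. Separating the arguments allows polarizing the
  quadratic expression in \<open>singular_relation\<close>.\<close>

definition cross1 :: "lin \<Rightarrow> lin \<Rightarrow> complex"
  where "cross1 h k = - cnj (col2 k) * diag h + cnj (col1 k) * offdiag h"
definition cross2 :: "lin \<Rightarrow> lin \<Rightarrow> complex"
  where "cross2 h k = - cnj (col2 k) * cnj (offdiag h) - cnj (col1 k) * diag h"

lemma cross_bilinear:
  "cross1 (h + h') k = cross1 h k + cross1 h' k" "cross1 h (k + k') = cross1 h k + cross1 h k'"
  "cross2 (h + h') k = cross2 h k + cross2 h' k" "cross2 h (k + k') = cross2 h k + cross2 h k'"
  "cross1 (h - h') k = cross1 h k - cross1 h' k" "cross1 h (k - k') = cross1 h k - cross1 h k'"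
  "cross2 (h - h') k = cross2 h k - cross2 h' k" "cross2 h (k - k') = cross2 h k - cross2 h k'"
  "cross1 (r *\<^sub>R h) k = of_real r * cross1 h k" "cross1 h (r *\<^sub>R k) = of_real r * cross1 h k"
  "cross2 (r *\<^sub>R h) k = of_real r * cross2 h k" "cross2 h (r *\<^sub>R k) = of_real r * cross2 h k"
  by (simp_all add: cross1_def cross2_def entry_add entry_diff entry_scaleR algebra_simps)

text \<open>
  The members \<open>h + k\<close> and \<open>h - k\<close> of the pencil are singular as well; comparing their relations forces
  the parameter of \<open>h + k\<close> to be \<open>s + t\<close>.
\<close>

lemma polar_relation:
  assumes "h \<in> W" "k \<in> W" and indep: "col1 h * col2 k \<noteq> col2 h * col1 k"
    and h: "cross1 h h + s * col1 h = 0" "cross2 h h + s * col2 h = 0"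
    and k: "cross1 k k + t * col1 k = 0" "cross2 k k + t * col2 k = 0"
  shows "cross1 h k + cross1 k h + t * col1 h + s * col1 k = 0"
    and "cross2 h k + cross2 k h + t * col2 h + s * col2 k = 0"
proof -
  obtain S where S: "cross1 (h + k) (h + k) + S * col1 (h + k) = 0" "cross2 (h + k) (h + k) + S * col2 (h + k) = 0"
    using singular_relation[OF W_closed(1)[OF assms(1,2)]] unfolding cross1_def cross2_def by blast
  obtain D where D: "cross1 (h - k) (h - k) + D * col1 (h - k) = 0" "cross2 (h - k) (h - k) + D * col2 (h - k) = 0"
    using singular_relation[OF W_closed(2)[OF assms(1,2)]] unfolding cross1_def cross2_def by blast
  note eqs = S[unfolded cross_bilinear entry_add] D[unfolded cross_bilinear entry_diff]
  \<comment> \<open>Adding the relations of \<open>h + k\<close> and \<open>h - k\<close> cancels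
    the mixed terms; independence of the columns then kills both coefficients.\<close>
  have comb: "(S + D - 2 * s) * col1 h + (S - D - 2 * t) * col1 k = 0"
    "(S + D - 2 * s) * col2 h + (S - D - 2 * t) * col2 k = 0"
    using eqs h k by algebra+
  then have "(S + D - 2 * s) * (col1 h * col2 k - col2 h * col1 k) = 0"
    "(S - D - 2 * t) * (col1 h * col2 k - col2 h * col1 k) = 0"
    by algebra+
  then have "S + D = 2 * s" "S - D = 2 * t"
    using indep by simp_all
  then have "S = s + t"
    by algebra
  then show "cross1 h k + cross1 k h + t * col1 h + s * col1 k = 0"
    "cross2 h k + cross2 k h + t * col2 h + s * col2 k = 0"
    using eqs(1,2) h k by algebra+
qed

text \<open>
  The parameter \<open>t\<close> is defined by a linear formula, the polar relation with \<open>h1\<close>. The quadratic map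
  \<open>h \<mapsto> h (f h)\<close> then vanishes off the set where \<open>(c1, c2)\<close> is proportional to that of
  \<open>h1\<close>, and by the parallelogram law along \<open>h2\<close> it vanishes there too.
\<close>

lemma exists_focal_embedding_independent:
  assumes h12: "h1 \<in> W" "h2 \<in> W" and indep: "col1 h1 * col2 h2 \<noteq> col2 h1 * col1 h2"
  shows "\<exists>f. focal_embedding W f"
proof -
  obtain t1 where t1: "cross1 h1 h1 + t1 * col1 h1 = 0" "cross2 h1 h1 + t1 * col2 h1 = 0"
    using singular_relation[OF h12(1)] unfolding cross1_def cross2_def by blast
  define n where "n = col1 h1 * cnj (col1 h1) + col2 h1 * cnj (col2 h1)"
  have "n = complex_of_real ((cmod (col1 h1))\<^sup>2 + (cmod (col2 h1))\<^sup>2)"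
    by (simp add: n_def flip: complex_norm_square)
  moreover have "col1 h1 \<noteq> 0 \<or> col2 h1 \<noteq> 0"
    using indep by auto
  ultimately have n: "n \<noteq> 0"
    by (simp only: of_real_eq_0_iff sum_power2_eq_zero_iff) auto
  define Y1 where "Y1 h = cross1 h h1 + cross1 h1 h + t1 * col1 h" for h
  define Y2 where "Y2 h = cross2 h h1 + cross2 h1 h + t1 * col2 h" for h
  \<comment> \<open>Projection onto the column of \<open>h1\<close>: if \<open>(Y1 h, Y2 h)\<close>
    is \<open>- s\<close> times that column, then \<open>t h = s\<close>.\<close>
  define t where "t h = - (cnj (col1 h1) * Y1 h + cnj (col2 h1) * Y2 h) / n" for h
  have linY: "Y1 (h + k) = Y1 h + Y1 k" "Y1 (r *\<^sub>R h) = of_real r * Y1 h"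
    "Y2 (h + k) = Y2 h + Y2 k" "Y2 (r *\<^sub>R h) = of_real r * Y2 h" for h k r
    unfolding Y1_def Y2_def cross_bilinear entry_add entry_scaleR by (simp_all add: algebra_simps)
  have lin: "t (h + k) = t h + t k" "t (r *\<^sub>R h) = of_real r * t h" for h k r
    unfolding t_def linY using n by (simp_all add: field_simps)
  have lin_diff: "t (h - k) = t h - t k" for h k
    using lin(1)[of "h - k" k] by simp
  have Q_indep: "cross1 h h + t h * col1 h = 0" "cross2 h h + t h * col2 h = 0"
    if h: "h \<in> W" "col1 h * col2 h1 \<noteq> col2 h * col1 h1" for h
  proof -
    obtain s where s: "cross1 h h + s * col1 h = 0" "cross2 h h + s * col2 h = 0"
      using singular_relation[OF h(1)] unfolding cross1_def cross2_def by blast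
    have "Y1 h = - s * col1 h1" "Y2 h = - s * col2 h1"
      using polar_relation[OF that(1) h12(1) that(2) s t1] unfolding Y1_def Y2_def by algebra+
    then have "t h = s"
      using n by (simp add: t_def field_simps n_def)
    then show "cross1 h h + t h * col1 h = 0" "cross2 h h + t h * col2 h = 0"
      using s by simp_all
  qed
  have Q: "cross1 h h + t h * col1 h = 0 \<and> cross2 h h + t h * col2 h = 0" if "h \<in> W" for h
  proof (cases "col1 h * col2 h1 = col2 h * col1 h1")
    case True
    then have "col1 (h + h2) * col2 h1 \<noteq> col2 (h + h2) * col1 h1" "col1 (h - h2) * col2 h1 \<noteq> col2 (h - h2) * col1 h1"
      "col1 h2 * col2 h1 \<noteq> col2 h2 * col1 h1"
      using indep unfolding entry_add entry_diff by (simp_all add: algebra_simps)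
    note eqs = Q_indep[OF W_closed(1)[OF that h12(2)] this(1)] Q_indep[OF W_closed(2)[OF that h12(2)] this(2)]
      Q_indep[OF h12(2) this(3)]
    have "2 * (cross1 h h + t h * col1 h) = 0" "2 * (cross2 h h + t h * col2 h) = 0"
      using eqs unfolding cross_bilinear lin lin_diff entry_add entry_diff by algebra+
    then show ?thesis
      by (metis mult_eq_0_iff zero_neq_numeral)
  qed (use Q_indep that in blast)
  define f where "f h = - cnj (col2 h) *s u1 + cnj (col1 h) *s u2 + t h *s p" for h
  have f_add: "f (h + k) = f h + f k" for h k
    unfolding f_def entry_add lin by (simp add: vector_sadd_rdistrib)
  have ker: "h *v f h = 0" if "h \<in> W" for h
    using Q[OF that] unfolding f_def image_eq_0_iff[OF that] cross1_def cross2_def by (simp add: mult.commute)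
  have "focal_embedding W (\<lambda>h. - cnj (col2 h) *s u1 + cnj (col1 h) *s u2 + t h *s p)"
  proof (rule focal_embeddingI)
    fix h assume h: "h \<in> W" and "- cnj (col2 h) *s u1 + cnj (col1 h) *s u2 + t h *s p = 0"
    then have fh: "f h = 0"
      by (simp add: f_def)
    \<comment> \<open>Polarize \<open>(h + k) (f (h + k)) = 0\<close> and use
      \<open>f h = 0\<close>. Thus \<open>h\<close> kills the independent vectors
      \<open>f h1\<close> and \<open>f h2\<close>, which \<open>kernel_line\<close> forbids for
      \<open>h \<noteq> 0\<close>.\<close>
    have "h *v f k = 0" if "k \<in> W" for k
      using ker[OF W_closed(1)[OF h that]] ker[OF h] ker[OF that] fh
      by (simp add: f_add matrix_vector_mult_add_rdistrib matrix_vector_right_distrib)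
    then have hf: "h *v f h1 = 0" "h *v f h2 = 0"
      using h12 by simp_all
    have "f h1 \<noteq> 0"
      using indep unfolding f_def eq_zero_iff adapted_coefficients by auto
    show "h = 0"
    proof (rule ccontr)
      assume "h \<noteq> 0"
      then obtain c where "f h2 = c *s f h1"
        using kernel_line[OF h _ \<open>f h1 \<noteq> 0\<close> hf] by blast
      then have "F (f h2) u1 = c * F (f h1) u1" "F (f h2) u2 = c * F (f h1) u2"
        by (simp_all add: smult_left)
      then have "cnj (col2 h2) = c * cnj (col2 h1)" "cnj (col1 h2) = c * cnj (col1 h1)"
        unfolding f_def adapted_coefficients by simp_all
      then have "col2 h2 = cnj c * col2 h1" "col1 h2 = cnj c * col1 h1"
        by (metis complex_cnj_cnj complex_cnj_mult)+
      then show False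
        using indep by simp
    qed
  qed (use ker in \<open>simp_all add: f_def entry_add entry_scaleR lin algebra_simps\<close>)
  then show ?thesis
    by (rule exI[of "focal_embedding W"])
qed

lemma exists_focal_embedding: "\<exists>f. focal_embedding W f"
  using exists_focal_embedding_dependent exists_focal_embedding_independent by blast

end

subsection \<open>Uniqueness of the embedding\<close>

context adapted_family
begin

lemma focal_embeddingD:
  assumes "focal_embedding W f"
  shows "h \<in> W \<Longrightarrow> k \<in> W \<Longrightarrow> f (h + k) = f h + f k" "h \<in> W \<Longrightarrow> f (r *\<^sub>R h) = r *\<^sub>R f h"
    "h \<in> W \<Longrightarrow> h *v f h = 0" "h \<in> W \<Longrightarrow> f h = 0 \<longleftrightarrow> h = 0"
proof -
  have f: "\<And>h k. h \<in> W \<Longrightarrow> k \<in> W \<Longrightarrow> f (h + k) = f h + f k" "\<And>h r. h \<in> W \<Longrightarrow> f (r *\<^sub>R h) = r *\<^sub>R f h"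
    "inj_on f W" "\<And>h. h \<in> W \<Longrightarrow> h *v f h = 0"
    using assms unfolding focal_embedding_def real_embedding_on_def by blast+
  show "h \<in> W \<Longrightarrow> k \<in> W \<Longrightarrow> f (h + k) = f h + f k" "h \<in> W \<Longrightarrow> f (r *\<^sub>R h) = r *\<^sub>R f h"
    "h \<in> W \<Longrightarrow> h *v f h = 0"
    by (fact f)+
  have "f 0 = 0"
    using f(2)[OF W_closed(4), of 0] by simp
  then show "h \<in> W \<Longrightarrow> f h = 0 \<longleftrightarrow> h = 0"
    using f(3) W_closed(4) by (metis inj_onD)
qed

text \<open>Otherwise \<open>v\<close> would be a common focus of the whole family, against
  nonconfocality.\<close>

lemma focal_image_not_in_line:
  assumes "focal_embedding W f"
  shows "\<not> (\<forall>h\<in>W. \<exists>c. f h = c *s v)"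
proof
  assume line: "\<forall>h\<in>W. \<exists>c. f h = c *s v"
  note f = focal_embeddingD[OF assms]
  have "axis 1 1 \<noteq> (0 :: V)"
    by simp
  then obtain h0 where "h0 \<in> W" "h0 \<noteq> 0"
    using nonconf by (metis matrix_vector_mult_0)
  then have "v \<noteq> 0"
    using line f(4) by fastforce
  moreover have "h *v v = 0" if h: "h \<in> W" for h
  proof (cases "h = 0")
    case False
    obtain c where c: "f h = c *s v"
      using line h by blast
    then have "c *s (h *v v) = 0" "c \<noteq> 0"
      using f(3,4)[OF h] False by (auto simp: vector_scalar_commute)
    then show ?thesis
      by simp
  qed simp
  ultimately show False
    using nonconf by blast
qed

text \<open>One-dimensional kernels give a ratio of \<open>g h\<close> to \<open>f h\<close> for
  each \<open>h\<close>. Comparing at \<open>h + k\<close> shows equal ratios when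
  \<open>f h\<close> and \<open>f k\<close> are independent; dependent values are compared through a
  third one off their line.\<close>

lemma focal_embedding_unique:
  assumes "focal_embedding W f" "focal_embedding W g"
  shows "\<exists>c. c \<noteq> 0 \<and> (\<forall>h\<in>W. g h = c *s f h)"
proof -
  note f = focal_embeddingD[OF assms(1)] and g = focal_embeddingD[OF assms(2)]
  have ex: "\<exists>c. g h = c *s f h" if "h \<in> W" for h
  proof (cases "h = 0")
    case True
    then show ?thesis
      using f(4) g(4) that by (metis vector_smult_rzero)
  next
    case False
    then show ?thesis
      using kernel_line[OF that] f(3,4) g(3) that by blast
  qed
  have same: "a = b" if hk: "h \<in> W" "k \<in> W" "h \<noteq> 0" "\<And>c. f k \<noteq> c *s f h"
    "g h = a *s f h" "g k = b *s f k" for h k a b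
  proof -
    obtain d where "g (h + k) = d *s f (h + k)"
      using ex W_closed(1) hk by blast
    then have *: "(b - d) *s f k = (d - a) *s f h"
      using f(1) g(1) hk by (simp add: vector_add_ldistrib vector_sub_rdistrib algebra_simps)
    have "b = d"
    proof (rule ccontr)
      assume "b \<noteq> d"
      then have "f k = (1 / (b - d)) *s ((b - d) *s f k)"
        by (simp only: vector_smult_assoc) simp
      then show False
        using hk(4) unfolding * vector_smult_assoc by blast
    qed
    then show ?thesis
      using * f(4)[OF hk(1)] hk(3) by simp
  qed
  obtain h0 where h0: "h0 \<in> W" "h0 \<noteq> 0"
    using focal_image_not_in_line[OF assms(1), of 0] f(4) by fastforce
  obtain k0 where k0: "k0 \<in> W" "\<And>c. f k0 \<noteq> c *s f h0"
    using focal_image_not_in_line[OF assms(1)] by blast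
  obtain c where c: "g h0 = c *s f h0"
    using ex h0 by blast
  have ck: "g k0 = c *s f k0"
    using ex[OF k0(1)] same[OF h0(1) k0(1) h0(2) k0(2) c] by blast
  have "g l = c *s f l" if l: "l \<in> W" for l
  proof -
    obtain d where d: "g l = d *s f l"
      using ex l by blast
    consider "l = 0" | "\<And>e. f l \<noteq> e *s f h0" | e where "l \<noteq> 0" "f l = e *s f h0"
      by blast
    then show ?thesis
    proof cases
      case 1
      then show ?thesis
        using f(4)[OF l] g(4)[OF l] by simp
    next
      case 2
      then show ?thesis
        using same[OF h0(1) l h0(2) 2 c d] d by simp
    next
      case 3
      have "f k0 \<noteq> e' *s f l" for e'
        using k0(2) 3(2) by (simp add: vector_smult_assoc)
      then show ?thesis
        using same[OF l k0(1) 3(1) _ d ck] d by simp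
    qed
  qed
  moreover have "c \<noteq> 0"
    using c g(4)[OF h0(1)] h0(2) by auto
  ultimately show ?thesis
    by blast
qed

end

subsection \<open>The span of the image\<close>

locale focal_family = adapted_family +
  fixes f :: "lin \<Rightarrow> V"
  assumes focal: "focal_embedding W f"
begin

lemmas f_add = focal_embeddingD(1)[OF focal]
  and f_scaleR = focal_embeddingD(2)[OF focal]
  and f_kernel = focal_embeddingD(3)[OF focal]
  and f_eq_0_iff = focal_embeddingD(4)[OF focal]

lemma f_polar: "k *v f h = - (h *v f k)" if "h \<in> W" "k \<in> W"
  using f_kernel[OF W_closed(1)[OF that]] f_kernel[OF that(1)] f_kernel[OF that(2)]
  by (simp add: f_add that matrix_vector_mult_add_rdistrib matrix_vector_right_distrib eq_neg_iff_add_eq_0)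

section \<open>The alternating trilinear form of the family\<close>

definition tri :: "lin \<Rightarrow> lin \<Rightarrow> lin \<Rightarrow> complex" where "tri h k l = F (h *v f k) (f l)"

lemma tri_swap12: "tri k h l = - tri h k l" if "h \<in> W" "k \<in> W"
  by (simp add: tri_def f_polar[OF that] minus_left)

lemma tri_swap23_cnj: "tri h l k = cnj (tri h k l)" if "h \<in> W"
  unfolding tri_def using selfadj[OF that] cnj_swap by metis

text \<open>The transposition (13) is both (12)(23)(12) and (23)(12)(23). As (12) negates and (23)
  conjugates, the first word gives the conjugate and the second the negative.\<close>

lemma tri_imaginary: "cnj (tri h k l) = - tri h k l" if "h \<in> W" "k \<in> W" "l \<in> W"
  using tri_swap12[of h k l] tri_swap12[of k l h] tri_swap12[of l h k] tri_swap23_cnj[of k h l]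
    tri_swap23_cnj[of l h k] tri_swap23_cnj[of h k l] that
  by (metis complex_cnj_cnj complex_cnj_minus minus_minus)

lemma tri_swap23: "tri h l k = - tri h k l" if "h \<in> W" "k \<in> W" "l \<in> W"
  using tri_swap23_cnj[OF that(1)] tri_imaginary[OF that] by metis

lemma tri_cyclic: "tri k l h = tri h k l" if "h \<in> W" "k \<in> W" "l \<in> W"
  using tri_swap12[of h k l] tri_swap23[of k h l] that by simp

lemma tri_repeated: "h \<in> W \<Longrightarrow> tri h h k = 0"
  "h \<in> W \<Longrightarrow> k \<in> W \<Longrightarrow> tri h k k = 0" "h \<in> W \<Longrightarrow> tri h k h = 0"
proof -
  show "h \<in> W \<Longrightarrow> tri h h k = 0" for h k
    by (simp add: tri_def f_kernel)
  show outer: "h \<in> W \<Longrightarrow> tri h k h = 0" for h k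
    by (simp add: tri_def selfadj f_kernel)
  show "h \<in> W \<Longrightarrow> k \<in> W \<Longrightarrow> tri h k k = 0"
    using tri_swap12[of h k k] outer[of k h] by simp
qed

text \<open>Complex dependence of the values of \<open>f\<close> gives no real dependence in
  \<open>W\<close>, so alternation alone does not suffice. Instead, \<open>h\<close> is applied to
  \<open>f h = a *s f k + b *s f l\<close> and the result paired with \<open>f l\<close> and
  \<open>f k\<close>.\<close>

lemma tri_eq_0:
  assumes U: "vec.dim (vec.span (f ` W)) = 2" and W: "h \<in> W" "k \<in> W" "l \<in> W"
  shows "tri h k l = 0"
proof (cases "h = 0 \<or> k = 0 \<or> (\<exists>c. f l = c *s f k)")
  case True
  then show ?thesis
    using tri_repeated(2)[OF W(1,2)] f_eq_0_iff[OF W(2)] unfolding tri_def by (auto simp: smult_right)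
next
  case False
  then have indep: "vec.independent {f k, f l}" "card {f k, f l} = 2"
    using vec_independent_pair[of "f k" "f l"] f_eq_0_iff[OF W(2)] by auto
  moreover have "{f k, f l} \<subseteq> vec.span (f ` W)"
    using W by (auto intro: vec.span_base)
  ultimately have "vec.span (f ` W) \<subseteq> vec.span {f k, f l}"
    using U vec.card_ge_dim_independent[of "{f k, f l}" "vec.span (f ` W)"] by simp
  then have "f h \<in> vec.span {f k, f l}"
    using W by (meson image_eqI subsetD vec.span_base)
  then obtain a b where ab: "f h = a *s f k + b *s f l"
    by (auto simp: vec.span_insert vec.span_singleton algebra_simps)
  have "a *s (h *v f k) + b *s (h *v f l) = 0"
    using f_kernel[OF W(1)] unfolding ab by (simp add: matrix_vector_right_distrib vector_scalar_commute)
  then have "F (a *s (h *v f k) + b *s (h *v f l)) (f l) = 0" "F (a *s (h *v f k) + b *s (h *v f l)) (f k) = 0"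
    by simp_all
  then have "a * tri h k l = 0" "b * tri h l k = 0"
    using tri_repeated(2)[OF W(1)] W unfolding form_simps tri_def[symmetric] by simp_all
  then show ?thesis
    using ab f_eq_0_iff[OF W(1)] False tri_swap23[OF W] by auto
qed

text \<open>The vanishing spreads to the complex span one argument at a time; self-adjointness
  exchanges the arguments in between.\<close>

lemma image_orth:
  assumes tri0: "\<And>h k l. h \<in> W \<Longrightarrow> k \<in> W \<Longrightarrow> l \<in> W \<Longrightarrow> tri h k l = 0"
    and h: "h \<in> W" and u: "u \<in> vec.span (f ` W)" and v: "v \<in> vec.span (f ` W)"
  shows "F (h *v u) v = 0"
proof -
  have "vec.subspace {y. F x y = 0}" for x
    by (auto simp: vec.subspace_def form_simps)
  then have *: "F x y = 0" if "\<And>l. l \<in> W \<Longrightarrow> F x (f l) = 0" "y \<in> vec.span (f ` W)" for x y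
    using that vec.span_minimal[of "f ` W" "{y. F x y = 0}"] by blast
  have "F (h *v f k) v = 0" if "k \<in> W" for k
    using * tri0[OF h that] v unfolding tri_def by blast
  then have "F (h *v v) (f k) = 0" if "k \<in> W" for k
    using that selfadj[OF h] cnj_swap by (metis complex_cnj_zero)
  then have "F (h *v v) u = 0"
    using * u by blast
  then show ?thesis
    using selfadj[OF h] cnj_swap by (metis complex_cnj_zero)
qed

section \<open>Image spanning a plane: the common slice\<close>

lemma focus_eq: "focus h = vec.span {f h}" if "h \<in> W" "h \<noteq> 0"
  using kernel_line[OF that] f_kernel[OF that(1)] f_eq_0_iff[OF that(1)] that(2)
  by (force simp: focus_def vec.span_singleton vector_scalar_commute)

lemma degenerate_case:
  assumes "vec.span (f ` W) = U" "U \<noteq> UNIV"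
  shows "vec.dim U = 2" "\<And>h. h \<in> W \<Longrightarrow> h \<noteq> 0 \<Longrightarrow> is_slice F h (proj U)" "W \<subseteq> slice_family F U"
proof -
  have U_pair: "vec.span {f h, f k} = U \<and> vec.dim U = 2"
    if hk: "h \<in> W" "h \<noteq> 0" "k \<in> W" "\<And>c. f k \<noteq> c *s f h" for h k
  proof -
    have indep: "vec.independent {f h, f k}" "card {f h, f k} = 2"
      using vec_independent_pair[of "f h" "f k"] f_eq_0_iff hk by auto
    have sub: "{f h, f k} \<subseteq> U"
      using hk assms(1) by (auto intro: vec.span_base)
    have "vec.dim U \<ge> 2"
      using vec.independent_card_le_dim[OF sub indep(1)] indep(2) by simp
    moreover have "vec.dim U \<noteq> 3"
      using assms vec_dim_eq_3_iff[of U] by (metis vec.span_span)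
    moreover have "vec.dim U \<le> 3"
      by (rule vec_dim_le_3)
    ultimately have dimU: "vec.dim U = 2"
      by linarith
    have "U \<subseteq> vec.span {f h, f k}"
      using vec.card_ge_dim_independent[OF sub indep(1)] dimU indep(2) by simp
    moreover have "vec.span {f h, f k} \<subseteq> U"
      using sub assms(1) by (metis vec.span_minimal vec.subspace_span)
    ultimately show ?thesis
      using dimU by blast
  qed
  have ex: "\<exists>k\<in>W. \<forall>c. f k \<noteq> c *s f h" for h
    using focal_image_not_in_line[OF focal, of "f h"] by blast
  obtain h0 where "h0 \<in> W" "h0 \<noteq> 0"
    using focal_image_not_in_line[OF focal, of 0] f_eq_0_iff by fastforce
  then show dimU: "vec.dim U = 2"
    using U_pair ex by blast
  have orth: "F (h *v u) v = 0" if "h \<in> W" "u \<in> U" "v \<in> U" for h u v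
    using image_orth tri_eq_0 dimU that assms(1) by blast
  then show "W \<subseteq> slice_family F U"
    using trace_W selfadj by (auto simp: slice_family_def is_adjoint_def orth_def)
  fix h assume h: "h \<in> W" "h \<noteq> 0"
  obtain k where k: "k \<in> W" "\<And>c. f k \<noteq> c *s f h"
    using ex by blast
  \<comment> \<open>A point of the bisector other than the focus; joined with the focus it spans
    \<open>U\<close>.\<close>
  define q where "q = vec.span {f k}"
  have "f k \<noteq> 0"
    using k(2)[of 0] by simp
  then have "q \<in> proj UNIV"
    by (simp add: q_def proj_def)
  have "q \<subseteq> U"
    unfolding q_def using U_pair[OF h k] vec.span_mono[of "{f k}" "{f h, f k}"] by auto
  then have "q \<in> bis F h"
    using \<open>q \<in> proj UNIV\<close> orth h(1) by (auto simp: bis_def)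
  moreover have "f k \<in> q"
    by (simp add: q_def vec.span_base)
  moreover have "f k \<notin> focus h"
    using k(2) by (auto simp: focus_eq[OF h] vec.span_singleton)
  ultimately have q: "q \<in> bis F h - {focus h}"
    by auto
  have "rank h = 2"
    using rank_eq_2I[of h "f h"] det_W[OF h(1)] h kernel_line[OF h _ f_kernel[OF h(1)]] f_eq_0_iff[OF h(1)] by blast
  moreover have "self_adjoint F h"
    unfolding is_adjoint_def using selfadj[OF h(1)] by blast
  moreover have "bis F h \<noteq> {focus h}"
    using q by blast
  ultimately have "is_bisector F h"
    unfolding is_bisector_def using trace_W[OF h(1)] by blast
  moreover have "vec.span (focus h \<union> q) = U"
  proof -
    have "vec.span (vec.span {f h} \<union> vec.span {f k}) = vec.span {f h, f k}"
    proof
      show "vec.span (vec.span {f h} \<union> vec.span {f k}) \<subseteq> vec.span {f h, f k}"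
        by (intro vec.span_minimal Un_least vec.span_mono vec.subspace_span) auto
      show "vec.span {f h, f k} \<subseteq> vec.span (vec.span {f h} \<union> vec.span {f k})"
        by (intro vec.span_mono) (auto intro: vec.span_base)
    qed
    then show ?thesis
      using U_pair[OF h k] unfolding focus_eq[OF h] q_def by blast
  qed
  ultimately show "is_slice F h (proj U)"
    using q unfolding is_slice_def by blast
qed

section \<open>Image spanning the whole space: the totally real case\<close>

lemma nondegenerate_case:
  assumes "vec.span (f ` W) = UNIV"
  shows "dim W = 3" "totally_real F (f ` W)"
proof -
  obtain B where B: "B \<subseteq> f ` W" "vec.independent B" "f ` W \<subseteq> vec.span B"
    using vec.maximal_independent_subset by blast
  have spanB: "vec.span B = UNIV"
    using assms B(3) by (metis vec.span_minimal vec.subspace_span top.extremum_uniqueI)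
  then have "card B = 3"
    using vec.dim_eq_card_independent[OF B(2)] vec_dim_eq_3_iff[of B] by simp
  then obtain h1 h2 h3 where h: "h1 \<in> W" "h2 \<in> W" "h3 \<in> W" and B_eq: "B = {f h1, f h2, f h3}"
    using B(1) by (auto simp: card_3_iff)
  have "h1 \<noteq> 0"
    using B(2) B_eq f_eq_0_iff[OF h(1)] vec.dependent_zero[of B] by auto
  have test: "x = 0" if "F x (f h1) = 0" "F x (f h2) = 0" "F x (f h3) = 0" for x
  proof (rule nondegenerate)
    fix y
    have "vec.subspace {y. F x y = 0}"
      by (auto simp: vec.subspace_def form_simps)
    then have "vec.span B \<subseteq> {y. F x y = 0}"
      using that B_eq by (intro vec.span_minimal) auto
    then show "F x y = 0"
      using spanB by auto
  qed
  define m where "m = tri h1 h2 h3"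
  have tri_m: "tri h1 h2 h3 = m" "tri h2 h3 h1 = m" "tri h3 h1 h2 = m"
    "tri h1 h3 h2 = - m" "tri h2 h1 h3 = - m" "tri h3 h2 h1 = - m"
    using tri_cyclic[OF h] tri_cyclic[OF h(2,3,1)] tri_swap23[OF h] tri_swap23[OF h(2,3,1)] tri_swap23[OF h(3,1,2)]
    by (simp_all add: m_def)
  \<comment> \<open>Antisymmetry in the last two arguments turns these three numbers into all
    pairings of \<open>k\<close> on the basis.\<close>
  have zero_if: "k = 0" if k: "k \<in> W" "tri k h1 h2 = 0" "tri k h2 h3 = 0" "tri k h3 h1 = 0" for k
  proof -
    have "tri k h2 h1 = 0" "tri k h3 h2 = 0" "tri k h1 h3 = 0"
      using tri_swap23[OF k(1) h(1,2)] tri_swap23[OF k(1) h(2,3)] tri_swap23[OF k(1) h(3,1)] k by simp_all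
    then have "k *v f h1 = 0" "k *v f h2 = 0" "k *v f h3 = 0"
      using k tri_repeated(2)[OF k(1)] h by (auto intro!: test simp: tri_def)
    moreover have "vec.subspace {x. k *v x = 0}"
      by (auto simp: vec.subspace_def matrix_vector_right_distrib vector_scalar_commute)
    ultimately have "vec.span B \<subseteq> {x. k *v x = 0}"
      unfolding B_eq by (intro vec.span_minimal) auto
    then show "k = 0"
      using spanB by (auto simp: matrix_eq)
  qed
  have "m \<noteq> 0"
    using zero_if[OF h(1)] \<open>h1 \<noteq> 0\<close> tri_m tri_repeated h by auto
  \<comment> \<open>By alternation \<open>h2 *v f h3\<close> pairs to \<open>m\<close> with
    \<open>f h1\<close> and to zero with \<open>f h2\<close> and \<open>f h3\<close>; cyclically for
    the others.\<close>
  define g1 where "g1 = (1 / m) *s (h2 *v f h3)"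
  define g2 where "g2 = (1 / m) *s (h3 *v f h1)"
  define g3 where "g3 = (1 / m) *s (h1 *v f h2)"
  have gf: "F g1 (f h1) = 1" "F g1 (f h2) = 0" "F g1 (f h3) = 0"
    "F g2 (f h1) = 0" "F g2 (f h2) = 1" "F g2 (f h3) = 0"
    "F g3 (f h1) = 0" "F g3 (f h2) = 0" "F g3 (f h3) = 1"
    unfolding g1_def g2_def g3_def smult_left tri_def[symmetric] using \<open>m \<noteq> 0\<close> tri_m tri_repeated h by simp_all
  have fg: "F (f h1) g1 = 1" "F (f h2) g1 = 0" "F (f h3) g1 = 0"
    "F (f h1) g2 = 0" "F (f h2) g2 = 1" "F (f h3) g2 = 0"
    "F (f h1) g3 = 0" "F (f h2) g3 = 0" "F (f h3) g3 = 1"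
    using gf by (metis cnj_swap complex_cnj_zero complex_cnj_one)+
  have expand_f: "x = F x g1 *s f h1 + F x g2 *s f h2 + F x g3 *s f h3" for x
    by (rule dual_expansion_3) (fact fg)+
  have expand_g: "x = F x (f h1) *s g1 + F x (f h2) *s g2 + F x (f h3) *s g3" for x
    by (rule dual_expansion_3) (fact gf)+
  have hf: "h1 *v f h2 = m *s g3" "h2 *v f h3 = m *s g1" "h3 *v f h1 = m *s g2"
    using \<open>m \<noteq> 0\<close> by (simp_all add: g1_def g2_def g3_def vector_smult_assoc)
  have hf': "h2 *v f h1 = - (m *s g3)" "h3 *v f h2 = - (m *s g1)" "h1 *v f h3 = - (m *s g2)"
    using f_polar[OF h(1,2)] f_polar[OF h(2,3)] f_polar[OF h(3,1)] by (simp_all add: hf)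
  \<comment> \<open>This is where the trace condition enters.\<close>
  have "m * F g3 g2 = m * F g2 g3" "m * F g1 g3 = m * F g3 g1" "m * F g2 g1 = m * F g1 g2"
    using trace_dual[OF expand_f, of h1] trace_dual[OF expand_f, of h2] trace_dual[OF expand_f, of h3]
      trace_W h f_kernel
    by (simp_all add: hf hf' minus_left smult_left)
  then have "F g3 g2 = F g2 g3" "F g1 g3 = F g3 g1" "F g2 g1 = F g1 g2"
    using \<open>m \<noteq> 0\<close> by simp_all
  then have Im_gg: "Im (F g1 g1) = 0" "Im (F g2 g2) = 0" "Im (F g3 g3) = 0"
    "Im (F g1 g2) = 0" "Im (F g1 g3) = 0" "Im (F g2 g3) = 0"
    "Im (F g2 g1) = 0" "Im (F g3 g1) = 0" "Im (F g3 g2) = 0"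
    using cnj_swap by (metis Reals_cnj_iff complex_is_Real_iff)+
  \<comment> \<open>Inverting a real Gram matrix: the vector \<open>w\<close> built from the
    imaginary parts is orthogonal to every dual vector, hence zero.\<close>
  have dual_real: "F x (f h1) \<in> \<real>" "F x (f h2) \<in> \<real>" "F x (f h3) \<in> \<real>"
    if x: "F x g1 \<in> \<real>" "F x g2 \<in> \<real>" "F x g3 \<in> \<real>" for x
  proof -
    define w where "w = complex_of_real (Im (F x (f h1))) *s g1 + complex_of_real (Im (F x (f h2))) *s g2
      + complex_of_real (Im (F x (f h3))) *s g3"
    have "F w g = 0" if "Im (F g1 g) = 0" "Im (F g2 g) = 0" "Im (F g3 g) = 0" "F x g \<in> \<real>" for g
    proof -
      have "F x g = F x (f h1) * F g1 g + F x (f h2) * F g2 g + F x (f h3) * F g3 g"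
        using arg_cong[OF expand_g[of x], of "\<lambda>y. F y g"] by (simp add: form_simps)
      then have "Im (F x g) = Im (F x (f h1) * F g1 g + F x (f h2) * F g2 g + F x (f h3) * F g3 g)"
        by simp
      moreover have "Im (F x g) = 0"
        using that(4) by (simp add: complex_is_Real_iff)
      ultimately show ?thesis
        using that(1-3) by (simp add: w_def form_simps complex_eq_iff)
    qed
    then have "F w g1 = 0" "F w g2 = 0" "F w g3 = 0"
      using Im_gg x by simp_all
    then have "w = 0"
      using expand_f[of w] by simp
    then have "F w (f h1) = 0" "F w (f h2) = 0" "F w (f h3) = 0"
      by simp_all
    then show "F x (f h1) \<in> \<real>" "F x (f h2) \<in> \<real>" "F x (f h3) \<in> \<real>"
      by (simp_all add: w_def form_simps gf complex_is_Real_iff)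
  qed
  have W_sum: "\<exists>a b c. h = a *\<^sub>R h1 + b *\<^sub>R h2 + c *\<^sub>R h3" if hW: "h \<in> W" for h
  proof -
    \<comment> \<open>Both \<open>tri h k l\<close> and \<open>m\<close> are purely imaginary, so
      their quotient is real.\<close>
    have "\<exists>r. tri h k l = of_real r * m" if "k \<in> W" "l \<in> W" for k l
    proof -
      have "cnj (tri h k l / m) = tri h k l / m"
        using tri_imaginary[OF hW that] tri_imaginary[OF h] by (simp add: tri_m)
      then obtain r where "tri h k l / m = of_real r"
        by (metis Reals_cnj_iff Reals_cases)
      then show ?thesis
        using \<open>m \<noteq> 0\<close> by (auto simp: field_simps)
    qed
    then obtain a b c where abc: "tri h h2 h3 = of_real a * m" "tri h h3 h1 = of_real b * m" "tri h h1 h2 = of_real c * m"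
      using h by meson
    let ?k = "h - (a *\<^sub>R h1 + b *\<^sub>R h2 + c *\<^sub>R h3)"
    have "?k \<in> W"
      using W_closed h hW by simp
    moreover have tri_k: "tri ?k x y = tri h x y - (of_real a * tri h1 x y + of_real b * tri h2 x y + of_real c * tri h3 x y)" for x y
      by (simp add: tri_def matrix_vector_mult_diff_rdistrib matrix_vector_mult_add_rdistrib scaleR_matrix_vector form_simps)
    have "tri ?k h1 h2 = 0" "tri ?k h2 h3 = 0" "tri ?k h3 h1 = 0"
      unfolding tri_k abc by (simp_all add: tri_m tri_repeated h)
    ultimately have "?k = 0"
      using zero_if by blast
    then show ?thesis
      by auto
  qed
  have f_sum: "f (a *\<^sub>R h1 + b *\<^sub>R h2 + c *\<^sub>R h3) = a *\<^sub>R f h1 + b *\<^sub>R f h2 + c *\<^sub>R f h3" for a b c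
    using h W_closed by (simp add: f_add f_scaleR)
  have indep_f: "a = 0 \<and> b = 0 \<and> c = 0" if "a *\<^sub>R f h1 + b *\<^sub>R f h2 + c *\<^sub>R f h3 = 0" for a b c
  proof -
    have "F (a *\<^sub>R f h1 + b *\<^sub>R f h2 + c *\<^sub>R f h3) g1 = a" "F (a *\<^sub>R f h1 + b *\<^sub>R f h2 + c *\<^sub>R f h3) g2 = b"
      "F (a *\<^sub>R f h1 + b *\<^sub>R f h2 + c *\<^sub>R f h3) g3 = c"
      by (simp_all add: scaleR_eq_smult form_simps fg)
    then show ?thesis
      unfolding that by simp
  qed
  have "W = span {h1, h2, h3}"
    using W_sum W_closed h unfolding span_3 by auto
  moreover have "a = 0 \<and> b = 0 \<and> c = 0" if "a *\<^sub>R h1 + b *\<^sub>R h2 + c *\<^sub>R h3 = 0" for a b c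
    using indep_f f_sum[of a b c] f_eq_0_iff[OF W_closed(4)] that by simp
  ultimately show "dim W = 3"
    using dim_span_3 by metis
  have fW: "f ` W = span {f h1, f h2, f h3}"
    unfolding span_3
  proof (intro subset_antisym subsetI)
    fix x assume "x \<in> f ` W"
    then show "x \<in> {a *\<^sub>R f h1 + b *\<^sub>R f h2 + c *\<^sub>R f h3 | a b c. True}"
      using W_sum f_sum by blast
  next
    fix x assume "x \<in> {a *\<^sub>R f h1 + b *\<^sub>R f h2 + c *\<^sub>R f h3 | a b c. True}"
    then obtain a b c where "x = f (a *\<^sub>R h1 + b *\<^sub>R h2 + c *\<^sub>R h3)"
      unfolding f_sum by blast
    moreover have "a *\<^sub>R h1 + b *\<^sub>R h2 + c *\<^sub>R h3 \<in> W"
      using W_closed h by simp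
    ultimately show "x \<in> f ` W"
      by blast
  qed
  have ff: "F (f h) (f k) \<in> \<real>" if "h \<in> {h1, h2, h3}" "k \<in> {h1, h2, h3}" for h k
  proof -
    have "F (f h) g1 \<in> \<real>" "F (f h) g2 \<in> \<real>" "F (f h) g3 \<in> \<real>"
      using that(1) by (auto simp: fg)
    from dual_real[OF this] show ?thesis
      using that(2) by auto
  qed
  have "F x y \<in> \<real>" if xy: "x \<in> f ` W" "y \<in> f ` W" for x y
  proof -
    obtain a b c where x: "x = a *\<^sub>R f h1 + b *\<^sub>R f h2 + c *\<^sub>R f h3"
      using xy(1) unfolding fW span_3 by blast
    obtain a' b' c' where y: "y = a' *\<^sub>R f h1 + b' *\<^sub>R f h2 + c' *\<^sub>R f h3"
      using xy(2) unfolding fW span_3 by blast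
    show ?thesis
      unfolding x y by (simp add: scaleR_eq_smult form_simps ff)
  qed
  then show "totally_real F (f ` W)"
    using assms dim_span_3[OF indep_f] unfolding totally_real_def fW by auto
qed

end

section \<open>Passage to an adapted basis and assembly of the result\<close>

lemma adapted_family_exists:
  assumes "hermitian_form F" "signature_ppm F" "linear_family F W" "nonconfocal W"
  obtains u1 u2 p where "adapted_family F W u1 u2 p"
proof -
  interpret hermitian_ppm F
    by unfold_locales (use assms in auto)
  have fam: "subspace W" "\<And>h. h \<in> W \<Longrightarrow> trace h = 0 \<and> self_adjoint F h \<and> det h = 0"
    "base_locus F W \<inter> neg_ball F \<noteq> {}"
    using assms(3) unfolding linear_family_def bisector_family_def singular_part_def by auto
  then obtain q where q: "q \<in> base_locus F W" "q \<in> neg_ball F"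
    by blast
  have "vec.dim q = 1"
    using q by (simp add: base_locus_def proj_def)
  then obtain v where v: "v \<in> q" "v \<noteq> 0"
    using vec.dim_eq_0[of q] by force
  have "Re (F v v) < 0"
    using q(2) v by (simp add: neg_ball_def)
  then obtain u1 u2 c where "c \<noteq> 0" "F u1 u1 = 1" "F u2 u2 = 1" "F (c *s v) (c *s v) = -1"
    "F u1 u2 = 0" "F u1 (c *s v) = 0" "F u2 (c *s v) = 0"
    using orthonormal_basis_at_negative by metis
  \<comment> \<open>Rescaling by \<open>c\<close> only multiplies \<open>F (h *v v) v = 0\<close> by
    the squared modulus of \<open>c\<close>.\<close>
  moreover have "F (h *v (c *s v)) (c *s v) = 0" if "h \<in> W" for h
    using q(1) v(1) that by (simp add: base_locus_def vector_scalar_commute form_simps)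
  ultimately have "adapted_family F W u1 u2 (c *s v)"
    using fam assms(4) by unfold_locales (auto simp: is_adjoint_def nonconfocal_def)
  then show ?thesis
    by (rule that)
qed

theorem proposition1p2p3:
  fixes F :: form and W :: "lin set"
  assumes "hermitian_form F" and "signature_ppm F"
    and "linear_family F W" and "nonconfocal W"
  shows "(\<exists>f. focal_embedding W f) \<and>
    (\<forall>f g. focal_embedding W f \<and> focal_embedding W g \<longrightarrow>
       (\<exists>c. c \<noteq> 0 \<and> (\<forall>h\<in>W. g h = c *s f h))) \<and>
    (\<forall>f U. focal_embedding W f \<and> U = vec.span (f ` W) \<longrightarrow>
       (U = UNIV \<longrightarrow> dim W = 3 \<and> totally_real F (f ` W)) \<and>
       (U \<noteq> UNIV \<longrightarrow>
          vec.dim U = 2 \<and>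
          (\<forall>h\<in>W. h \<noteq> 0 \<longrightarrow> is_slice F h (proj U)) \<and>
          W \<subseteq> slice_family F U))"
proof -
  obtain u1 u2 p where "adapted_family F W u1 u2 p"
    using adapted_family_exists assms by blast
  then interpret adapted_family F W u1 u2 p .
  have focal_family: "focal_family F W u1 u2 p f" if "focal_embedding W f" for f
    by unfold_locales (fact that)
  show ?thesis
  proof (intro conjI allI impI)
    show "\<exists>f. focal_embedding W f"
      by (rule exists_focal_embedding)
    show "\<exists>c. c \<noteq> 0 \<and> (\<forall>h\<in>W. g h = c *s f h)"
      if "focal_embedding W f \<and> focal_embedding W g" for f g
      using focal_embedding_unique that by blast
    fix f U
    assume fU: "focal_embedding W f \<and> U = vec.span (f ` W)"
    then interpret focal_family F W u1 u2 p f
      using focal_family by blast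
    show "dim W = 3" "totally_real F (f ` W)" if "U = UNIV"
      using nondegenerate_case fU that by simp_all
    show "vec.dim U = 2" "W \<subseteq> slice_family F U" if "U \<noteq> UNIV"
      using degenerate_case fU that by simp_all
    show "\<forall>h\<in>W. h \<noteq> 0 \<longrightarrow> is_slice F h (proj U)" if "U \<noteq> UNIV"
      using degenerate_case(2)[OF _ that] fU by simp
  qed
qed

end
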